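(* Let an ontic representation with ontic set $\Lambda$ be given, with valuation $1$-forms $\xi_{\lambda'}$ on $\mathcal{M}_{\mathcal{E}}$ (effects), $\Gamma_{\lambda'\lambda}$ on $\mathcal{M}_{\mathcal{T}}$ (transformations) and $\mu_{\lambda}$ on $\mathcal{M}_{\mathcal{P}}$ (states), where $\lambda,\lambda'\in\Lambda$. Suppose the contextual curvature vanishes, $F=0$, for every valuation $1$-form. Then the ontic representation is contextual if and only if it exhibits monodromy.
   Context: Generalized probability theory and ontic representation. A generalized probability theory has sets of states $\mathcal{P}$, transformations $\mathcal{T}$ and effects $\mathcal{E}$, each a convex subset of a finite-dimensional real vector space, and probabilities $p(E|T,P)\in[0,1]$. An ontic representation consists of a set $\Lambda$ of ontic (hidden) variables and valuation functions $\xi,\Gamma,\mu$, with values in $[0,1]$ on $\mathcal{E},\mathcal{T},\mathcal{P}$ respectively, such that $p(E|T,P)=\sum_{\lambda,\lambda'}\xi(E|\lambda')\,\Gamma(\lambda',T,\lambda)\,\mu(\lambda|P)$. Geometric encoding. For each $X\in\{\mathcal{E},\mathcal{T},\mathcal{P}\}$ there is a space $\mathcal{M}_X$, with possibly non-trivial topology, which is either a piecewise linear manifold given as an oriented simplicial complex (discrete case) or a smooth manifold (continuous case). $\mathcal{C}_n(\mathcal{M}_X)$ denotes its $n$-chains with real coefficients (simplicial chains, respectively smooth singular chains) with boundary operator $\partial$, and $\mathcal{C}^n(\mathcal{M}_X)$ denotes its $n$-forms (linear functionals on $\mathcal{C}_n$, respectively smooth differential $n$-forms) with coboundary operator $d$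 (the exterior derivative in the smooth case). The pairing is $\langle\omega|S\rangle=\int_S\omega\in\mathbb{R}$ for an $n$-form $\omega$ and an $n$-chain $S$, and it satisfies Stokes' theorem $\langle\omega|\partial S\rangle=\langle d\omega|S\rangle$. Objects (effects, transformations, states) are vectors, viewed as oriented $1$-dimensional pieces of $\mathcal{M}_X$, i.e. as $1$-chains $|E\rangle,|T\rangle,|P\rangle$. The valuation functions are $1$-forms: $\xi(E|\lambda')=\langle\xi_{\lambda'}|E\rangle$, $\Gamma(\lambda',T,\lambda)=\langle\Gamma_{\lambda'\lambda}|T\rangle$, $\mu(\lambda|P)=\langle\mu_{\lambda}|P\rangle$. Contextuality. A loop is a $1$-chain $\gamma$ with $\partial\gamma=0$. Operational equivalences (linear relations such as $\sum_r b_rE_r=0$ among objects) are identified with loops ($\gamma=\sum_r b_r|E_r\rangle$), and every loop is regarded as an operational equivalence. The representation is noncontextual if every valuation $1$-form $v$ (each $\xi_{\lambda'}$, $\Gamma_{\lambda'\lambda}$, $\mu_\lambda$) has zero phase $\phi=\langle v|\gamma\rangle=0$ along every loop $\gamma$ in the space on which it is defined; otherwise it is contextual. Curvature and monodromy. Each valuation $1$-form $v$ is written $v=dc+\omega$, with $c$ a function ($0$-form) on the corresponding space $\mathcal{M}_X$ and $\omega$ a $1$-form (the contextual connection). Its contextual curvature is $F=d\omega=dv$. The representation exhibits monodromy if for some valuation $1$-form $v=dc+\omega$ there is a loop $\gamma$ in the corresponding space that is not the boundary $\partial S$ of any $2$-chain (region) $S$ and along which the phase $\phi=\langle\omega|\gamma\rangle$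 is non-zero. *)

theory Defs
  imports
    "HOL-Analysis.Analysis"
    "HOL-Homology.Homology"
    "HOL-Combinatorics.Permutations"
    "HOL-Library.Function_Algebras"
begin

section \<open>Smooth maps\<close>

primrec Ck :: "nat \<Rightarrow> 'a::euclidean_space set \<Rightarrow> ('a \<Rightarrow> 'b::real_normed_vector) \<Rightarrow> bool" where
  "Ck 0 S f \<longleftrightarrow> continuous_on S f"
| "Ck (Suc k) S f \<longleftrightarrow> (\<forall>x\<in>S. f differentiable (at x)) \<and>
     (\<forall>v. Ck k S (\<lambda>x. frechet_derivative f (at x) v))"

text \<open>Only meaningful for open \<open>S\<close>.\<close>

definition smooth_on :: "'a::euclidean_space set \<Rightarrow> ('a \<Rightarrow> 'b::real_normed_vector) \<Rightarrow> bool" where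
  "smooth_on S f \<longleftrightarrow> (\<forall>k. Ck k S f)"

text \<open>Singular simplices live on \<open>standard_simplex n\<close>, a subset of the space \<open>nat \<Rightarrow> real\<close>, which
  carries the product topology but no norm. Smoothness on its open sets is therefore expressed by
  existence and continuity of all iterated directional derivatives; for functions of finitely many
  coordinates this is ordinary smoothness.\<close>

definition dir_deriv :: "(nat \<Rightarrow> real) \<Rightarrow> ((nat \<Rightarrow> real) \<Rightarrow> 'b::real_normed_vector) \<Rightarrow> (nat \<Rightarrow> real) \<Rightarrow> 'b" where
  "dir_deriv v h x = vector_derivative (\<lambda>t. h (\<lambda>i. x i + t * v i)) (at 0)"

primrec coord_Ck :: "nat \<Rightarrow> (nat \<Rightarrow> real) set \<Rightarrow> ((nat \<Rightarrow> real) \<Rightarrow> 'b::real_normed_vector) \<Rightarrow> bool" where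
  "coord_Ck 0 W h \<longleftrightarrow> continuous_on W h"
| "coord_Ck (Suc k) W h \<longleftrightarrow> continuous_on W h \<and>
     (\<forall>v. (\<forall>x\<in>W. (\<lambda>t::real. h (\<lambda>i. x i + t * v i)) differentiable (at 0)) \<and>
          coord_Ck k W (dir_deriv v h))"

definition coord_smooth_on :: "(nat \<Rightarrow> real) set \<Rightarrow> ((nat \<Rightarrow> real) \<Rightarrow> 'b::real_normed_vector) \<Rightarrow> bool" where
  "coord_smooth_on W h \<longleftrightarrow> (\<forall>k. coord_Ck k W h)"

section \<open>The spaces\<close>

text \<open>A chart is a pair \<open>(U, \<phi>)\<close>; the values of \<open>\<phi>\<close> outside \<open>U\<close> are irrelevant.\<close>

type_synonym ('m, 'e) chart = "'m set \<times> ('m \<Rightarrow> 'e)"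

definition smooth_manifold :: "'m topology \<Rightarrow> ('m, 'e::euclidean_space) chart set \<Rightarrow> bool" where
  "smooth_manifold X A \<longleftrightarrow>
     Hausdorff_space X \<and> second_countable X \<and>
     (\<Union>(U, \<phi>)\<in>A. U) = topspace X \<and>
     (\<forall>(U, \<phi>)\<in>A. openin X U \<and> open (\<phi> ` U) \<and>
        homeomorphic_map (subtopology X U) (top_of_set (\<phi> ` U)) \<phi>) \<and>
     (\<forall>(U, \<phi>)\<in>A. \<forall>(V, \<psi>)\<in>A. smooth_on (\<phi> ` (U \<inter> V)) (\<psi> \<circ> inv_into U \<phi>))"

text \<open>As \<^const>\<open>simplicial_complex\<close>, but locally finite instead of finite, so that non-compact
  spaces are allowed. As there, the empty simplex (of dimension \<open>-1\<close>) belongs to every non-empty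
  complex.\<close>

definition lf_simplicial_complex :: "'n::euclidean_space set set \<Rightarrow> bool" where
  "lf_simplicial_complex K \<longleftrightarrow>
     (\<forall>x\<in>\<Union>K. \<exists>U. open U \<and> x \<in> U \<and> finite {S \<in> K. S \<inter> U \<noteq> {}}) \<and>
     (\<forall>S\<in>K. \<exists>n. n simplex S) \<and>
     (\<forall>F S. S \<in> K \<and> F face_of S \<longrightarrow> F \<in> K) \<and>
     (\<forall>S S'. S \<in> K \<and> S' \<in> K \<longrightarrow> (S \<inter> S') face_of S)"

text \<open>A homeomorphism is piecewise linear if its graph is a compact polyhedron, i.e. a finite union
  of polytopes.\<close>

definition pl_homeomorphism ::
    "'a::euclidean_space set \<Rightarrow> 'b::euclidean_space set \<Rightarrow> ('a \<Rightarrow> 'b) \<Rightarrow> bool" where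
  "pl_homeomorphism S T f \<longleftrightarrow> (\<exists>g. homeomorphism S T f g) \<and>
     (\<exists>\<P>. finite \<P> \<and> (\<forall>Q\<in>\<P>. polytope Q) \<and> (\<lambda>x. (x, f x)) ` S = \<Union>\<P>)"

text \<open>Every point has a neighbourhood that is a piecewise linear ball of the fixed dimension \<open>d\<close>;
  any \<open>d\<close>-dimensional polytope may serve as the model ball. A (possibly empty) boundary is allowed.\<close>

definition pl_manifold :: "'n::euclidean_space set \<Rightarrow> bool" where
  "pl_manifold M \<longleftrightarrow> (\<exists>d. \<forall>x\<in>M. \<exists>U N (B::'n set) f.
     openin (top_of_set M) U \<and> x \<in> U \<and> U \<subseteq> N \<and> N \<subseteq> M \<and>
     polytope B \<and> aff_dim B = d \<and> pl_homeomorphism N B f)"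

text \<open>An orientation of a complex lists the vertices of each simplex in some order.\<close>

definition complex_orientation :: "'n::euclidean_space set set \<Rightarrow> ('n set \<Rightarrow> 'n list) \<Rightarrow> bool" where
  "complex_orientation K ori \<longleftrightarrow>
     (\<forall>S\<in>K. distinct (ori S) \<and> set (ori S) = {v. v extreme_point_of S})"

datatype ('n, 'm, 'e) geometry =
    Discrete "'n set set" "'n set \<Rightarrow> 'n list"
  | Continuous "'m topology" "('m, 'e) chart set"

fun valid_geometry :: "('n::euclidean_space, 'm, 'e::euclidean_space) geometry \<Rightarrow> bool" where
  "valid_geometry (Discrete K ori) \<longleftrightarrow>
     lf_simplicial_complex K \<and> complex_orientation K ori \<and> pl_manifold (\<Union>K)"
| "valid_geometry (Continuous X A) \<longleftrightarrow> smooth_manifold X A"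

section \<open>Chains\<close>

text \<open>Smooth on the closed simplex means: near every point of it, the simplex read in some chart
  extends to a smooth map on an open set.\<close>

definition smooth_singular_simplex ::
    "nat \<Rightarrow> 'm topology \<Rightarrow> ('m, 'e::euclidean_space) chart set \<Rightarrow> ((nat \<Rightarrow> real) \<Rightarrow> 'm) \<Rightarrow> bool" where
  "smooth_singular_simplex n X A \<sigma> \<longleftrightarrow> singular_simplex n X \<sigma> \<and>
     (\<forall>x\<in>standard_simplex n. \<exists>(U, \<phi>)\<in>A. \<exists>W h.
        open W \<and> x \<in> W \<and> coord_smooth_on W h \<and>
        (\<forall>y\<in>W \<inter> standard_simplex n. \<sigma> y \<in> U \<and> h y = \<phi> (\<sigma> y)))"

text \<open>Real chains are finitely supported real functions on cells. The two kinds of cells are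
  collected in one type so that both cases can be treated in one statement; a geometry only ever
  uses one of them.\<close>

datatype ('n, 'm) cell = Simplex "'n set" | Singular "(nat \<Rightarrow> real) \<Rightarrow> 'm"

type_synonym ('n, 'm) rchain = "('n, 'm) cell \<Rightarrow> real"

fun cells :: "('n::euclidean_space, 'm, 'e::euclidean_space) geometry \<Rightarrow> nat \<Rightarrow> ('n, 'm) cell set" where
  "cells (Discrete K ori) n = Simplex ` {S \<in> K. int n simplex S}"
| "cells (Continuous X A) n = Singular ` {\<sigma>. smooth_singular_simplex n X A \<sigma>}"

definition chains ::
    "('n::euclidean_space, 'm, 'e::euclidean_space) geometry \<Rightarrow> nat \<Rightarrow> ('n, 'm) rchain set" where
  "chains M n = {c. finite {\<sigma>. c \<sigma> \<noteq> 0} \<and> {\<sigma>. c \<sigma> \<noteq> 0} \<subseteq> cells M n}"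

definition ordering_sign :: "'a list \<Rightarrow> 'a list \<Rightarrow> real" where
  "ordering_sign xs ys = of_int (sign (THE p. p permutes set xs \<and> map p xs = ys))"

text \<open>The incidence number of a simplex \<open>S\<close> and a facet \<open>F\<close>, where \<open>x\<close> is the vertex of \<open>S\<close> opposite
  to \<open>F\<close>: it is \<open>1\<close> iff listing \<open>x\<close> before the vertices of \<open>F\<close> yields the orientation of \<open>S\<close>. This
  agrees with the formula \<open>\<partial>[x\<^sub>0,\<dots>,x\<^sub>n] = (\<Sum>i\<le>n. (-1)^i [\<dots>,x\<^sub>i\<^sub>-\<^sub>1,x\<^sub>i\<^sub>+\<^sub>1,\<dots>])\<close>.\<close>

definition incidence :: "('n::euclidean_space set \<Rightarrow> 'n list) \<Rightarrow> 'n set \<Rightarrow> 'n set \<Rightarrow> real" where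
  "incidence ori S F =
     (if F facet_of S then
        ordering_sign ((THE x. x extreme_point_of S \<and> x \<notin> F) # ori F) (ori S)
      else 0)"

fun cell_boundary ::
    "('n::euclidean_space, 'm, 'e::euclidean_space) geometry \<Rightarrow> nat \<Rightarrow> ('n, 'm) cell \<Rightarrow> ('n, 'm) rchain" where
  "cell_boundary (Discrete K ori) n (Simplex S) =
     (\<lambda>\<tau>. case \<tau> of Simplex F \<Rightarrow> incidence ori S F | Singular _ \<Rightarrow> 0)"
| "cell_boundary (Continuous X A) n (Singular \<sigma>) =
     (\<lambda>\<tau>. \<Sum>k\<le>n. (-1) ^ k * (if \<tau> = Singular (singular_face n k \<sigma>) then 1 else 0))"
| "cell_boundary _ n _ = 0"

definition boundary ::
    "('n::euclidean_space, 'm, 'e::euclidean_space) geometry \<Rightarrow> nat \<Rightarrow> ('n, 'm) rchain \<Rightarrow> ('n, 'm) rchain" where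
  "boundary M n c =
     (if n = 0 then 0 else (\<lambda>\<tau>. \<Sum>\<sigma> | c \<sigma> \<noteq> 0. c \<sigma> * cell_boundary M n \<sigma> \<tau>))"

section \<open>Forms\<close>

text \<open>A discrete form is a linear functional on chains. A differential \<open>n\<close>-form is given by its
  components: its value at a point \<open>p\<close> of a chart on \<open>n\<close> tangent vectors written in the coordinates
  of that chart. Both are real functions on the type of possible arguments, and both are
  required to be \<open>0\<close> on arguments that do not belong to the geometry, so that equality and the zero
  form have their ordinary meaning.\<close>

datatype ('n, 'm, 'e) form_arg =
    Chain "('n, 'm) rchain"
  | Frame "('m, 'e) chart" 'm "'e list"

type_synonym ('n, 'm, 'e) form = "('n, 'm, 'e) form_arg \<Rightarrow> real"

text \<open>The clauses for \<open>Continuous\<close>: smooth components, multilinear, alternating, and transforming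
  as a form under change of charts.\<close>

fun forms ::
    "('n::euclidean_space, 'm, 'e::euclidean_space) geometry \<Rightarrow> nat \<Rightarrow> ('n, 'm, 'e) form set" where
  "forms (Discrete K ori) n = {w.
     (\<forall>ch p vs. w (Frame ch p vs) = 0) \<and>
     (\<forall>c. c \<notin> chains (Discrete K ori :: ('n, 'm, 'e) geometry) n \<longrightarrow> w (Chain c) = 0) \<and>
     (\<forall>c \<in> chains (Discrete K ori :: ('n, 'm, 'e) geometry) n.
      \<forall>c' \<in> chains (Discrete K ori :: ('n, 'm, 'e) geometry) n. \<forall>a b.
        w (Chain (\<lambda>\<sigma>. a * c \<sigma> + b * c' \<sigma>)) = a * w (Chain c) + b * w (Chain c'))}"
| "forms (Continuous X A) n = {w.
     (\<forall>c. w (Chain c) = 0) \<and>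
     (\<forall>U \<phi> p vs. \<not> ((U, \<phi>) \<in> A \<and> p \<in> U \<and> length vs = n) \<longrightarrow> w (Frame (U, \<phi>) p vs) = 0) \<and>
     (\<forall>(U, \<phi>)\<in>A. \<forall>vs. length vs = n \<longrightarrow>
        smooth_on (\<phi> ` U) (\<lambda>x. w (Frame (U, \<phi>) (inv_into U \<phi> x) vs))) \<and>
     (\<forall>(U, \<phi>)\<in>A. \<forall>p\<in>U. \<forall>vs. length vs = n \<longrightarrow>
        (\<forall>i<n. linear (\<lambda>v. w (Frame (U, \<phi>) p (vs[i := v])))) \<and>
        (\<not> distinct vs \<longrightarrow> w (Frame (U, \<phi>) p vs) = 0)) \<and>
     (\<forall>(U, \<phi>)\<in>A. \<forall>(V, \<psi>)\<in>A. \<forall>p\<in>U \<inter> V. \<forall>vs. length vs = n \<longrightarrow>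
        w (Frame (U, \<phi>) p vs) =
        w (Frame (V, \<psi>) p (map (frechet_derivative (\<psi> \<circ> inv_into U \<phi>) (at (\<phi> p))) vs)))}"

text \<open>The exterior derivative in coordinates is
  \<open>d\<omega>(v\<^sub>0,\<dots>,v\<^sub>n) = (\<Sum>i\<le>n. (-1)^i D\<omega>(\<cdot>)[v\<^sub>i](\<dots>,v\<^sub>i\<^sub>-\<^sub>1,v\<^sub>i\<^sub>+\<^sub>1,\<dots>))\<close>.\<close>

fun coboundary ::
    "('n::euclidean_space, 'm, 'e::euclidean_space) geometry \<Rightarrow> nat \<Rightarrow>
     ('n, 'm, 'e) form \<Rightarrow> ('n, 'm, 'e) form" where
  "coboundary (Discrete K ori) n w (Chain c) =
     (if c \<in> chains (Discrete K ori :: ('n, 'm, 'e) geometry) (Suc n)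
      then w (Chain (boundary (Discrete K ori :: ('n, 'm, 'e) geometry) (Suc n) c)) else 0)"
| "coboundary (Continuous X A) n w (Frame (U, \<phi>) p vs) =
     (if (U, \<phi>) \<in> A \<and> p \<in> U \<and> length vs = Suc n
      then \<Sum>i\<le>n. (-1) ^ i *
        frechet_derivative
          (\<lambda>x. w (Frame (U, \<phi>) (inv_into U \<phi> x) (take i vs @ drop (Suc i) vs)))
          (at (\<phi> p)) (vs ! i)
      else 0)"
| "coboundary _ n w _ = 0"

text \<open>Integration of a differential 1-form along a smooth singular 1-simplex, parametrised by
  \<open>t \<in> [0,1]\<close> from vertex 0 to vertex 1. The choice of the chart does not matter for \<^term>\<open>w \<in> forms M 1\<close>.\<close>

definition segment_point :: "real \<Rightarrow> nat \<Rightarrow> real" where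
  "segment_point t = (\<lambda>i. if i = 0 then 1 - t else if i = 1 then t else 0)"

definition line_integral ::
    "('m, 'e::euclidean_space) chart set \<Rightarrow> ('n, 'm, 'e) form \<Rightarrow> ((nat \<Rightarrow> real) \<Rightarrow> 'm) \<Rightarrow> real" where
  "line_integral A w \<sigma> = integral {0..1} (\<lambda>t.
     let ch = (SOME ch. ch \<in> A \<and> \<sigma> (segment_point t) \<in> fst ch)
     in w (Frame ch (\<sigma> (segment_point t))
          [vector_derivative (\<lambda>s. snd ch (\<sigma> (segment_point s))) (at t within {0..1})]))"

fun pairing ::
    "('n::euclidean_space, 'm, 'e::euclidean_space) geometry \<Rightarrow>
     ('n, 'm, 'e) form \<Rightarrow> ('n, 'm) rchain \<Rightarrow> real" where
  "pairing (Discrete K ori) w c = w (Chain c)"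
| "pairing (Continuous X A) w c =
     (\<Sum>\<sigma> | c (Singular \<sigma>) \<noteq> 0. c (Singular \<sigma>) * line_integral A w \<sigma>)"

definition loops ::
    "('n::euclidean_space, 'm, 'e::euclidean_space) geometry \<Rightarrow> ('n, 'm) rchain set" where
  "loops M = {\<gamma> \<in> chains M 1. boundary M 1 \<gamma> = 0}"

section \<open>Ontic representations\<close>

text \<open>One record describes the data attached to the effects, to the transformations or to the
  states: \<open>'x\<close> is the ambient vector space of the objects and \<open>'i\<close> the type of indices of the
  valuation 1-forms. For each index \<open>i\<close> the valuation is written as \<open>v = dc + \<omega>\<close> with
  \<open>c = potential i\<close> and \<open>\<omega> = connection i\<close>.\<close>

record ('x, 'i, 'n, 'm, 'e) sector =
  objects :: "'x set"
  geom :: "('n, 'm, 'e) geometry"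
  ket :: "'x \<Rightarrow> ('n, 'm) rchain"
  valuation :: "'i \<Rightarrow> ('n, 'm, 'e) form"
  potential :: "'i \<Rightarrow> ('n, 'm, 'e) form"
  connection :: "'i \<Rightarrow> ('n, 'm, 'e) form"

definition val ::
    "('x, 'i, 'n::euclidean_space, 'm, 'e::euclidean_space) sector \<Rightarrow> 'i \<Rightarrow> 'x \<Rightarrow> real" where
  "val S i x = pairing (geom S) (valuation S i) (ket S x)"

definition geometric_encoding ::
    "'i set \<Rightarrow> ('x::euclidean_space, 'i, 'n::euclidean_space, 'm, 'e::euclidean_space) sector \<Rightarrow> bool" where
  "geometric_encoding I S \<longleftrightarrow>
     convex (objects S) \<and> valid_geometry (geom S) \<and>
     (\<forall>x\<in>objects S. ket S x \<in> chains (geom S) 1) \<and>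
     (\<forall>R b. finite R \<and> R \<subseteq> objects S \<and> (\<Sum>x\<in>R. b x *\<^sub>R x) = 0 \<longrightarrow>
        (\<lambda>\<sigma>. \<Sum>x\<in>R. b x * ket S x \<sigma>) \<in> loops (geom S)) \<and>
     (\<forall>i\<in>I. valuation S i \<in> forms (geom S) 1 \<and>
            (\<forall>x\<in>objects S. val S i x \<in> {0..1}) \<and>
            potential S i \<in> forms (geom S) 0 \<and>
            connection S i \<in> forms (geom S) 1 \<and>
            valuation S i = coboundary (geom S) 0 (potential S i) + connection S i)"

text \<open>The sum over \<open>\<Lambda> \<times> \<Lambda>\<close> is unconditional; it is an ordinary sum if \<open>\<Lambda>\<close> is finite.\<close>

definition ontic_representation ::
    "('x \<Rightarrow> 'y \<Rightarrow> 'z \<Rightarrow> real) \<Rightarrow> 'l set \<Rightarrow>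
     ('x::euclidean_space, 'l, 'n1::euclidean_space, 'm1, 'e1::euclidean_space) sector \<Rightarrow>
     ('y::euclidean_space, 'l \<times> 'l, 'n2::euclidean_space, 'm2, 'e2::euclidean_space) sector \<Rightarrow>
     ('z::euclidean_space, 'l, 'n3::euclidean_space, 'm3, 'e3::euclidean_space) sector \<Rightarrow> bool" where
  "ontic_representation p \<Lambda> \<E> \<T> \<P> \<longleftrightarrow>
     geometric_encoding \<Lambda> \<E> \<and> geometric_encoding (\<Lambda> \<times> \<Lambda>) \<T> \<and> geometric_encoding \<Lambda> \<P> \<and>
     (\<forall>E\<in>objects \<E>. \<forall>T\<in>objects \<T>. \<forall>P\<in>objects \<P>.
        p E T P \<in> {0..1} \<and>
        ((\<lambda>(l', l). val \<E> l' E * val \<T> (l', l) T * val \<P> l P) has_sum p E T P) (\<Lambda> \<times> \<Lambda>))"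

definition curvature ::
    "('x, 'i, 'n::euclidean_space, 'm, 'e::euclidean_space) sector \<Rightarrow> 'i \<Rightarrow> ('n, 'm, 'e) form" where
  "curvature S i = coboundary (geom S) 1 (connection S i)"

definition noncontextual_sector ::
    "'i set \<Rightarrow> ('x, 'i, 'n::euclidean_space, 'm, 'e::euclidean_space) sector \<Rightarrow> bool" where
  "noncontextual_sector I S \<longleftrightarrow>
     (\<forall>i\<in>I. \<forall>\<gamma>\<in>loops (geom S). pairing (geom S) (valuation S i) \<gamma> = 0)"

definition monodromy_sector ::
    "'i set \<Rightarrow> ('x, 'i, 'n::euclidean_space, 'm, 'e::euclidean_space) sector \<Rightarrow> bool" where
  "monodromy_sector I S \<longleftrightarrow>
     (\<exists>i\<in>I. \<exists>\<gamma>\<in>loops (geom S).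
        \<gamma> \<notin> boundary (geom S) 2 ` chains (geom S) 2 \<and>
        pairing (geom S) (connection S i) \<gamma> \<noteq> 0)"

definition contextual ::
    "'l set \<Rightarrow>
     ('x, 'l, 'n1::euclidean_space, 'm1, 'e1::euclidean_space) sector \<Rightarrow>
     ('y, 'l \<times> 'l, 'n2::euclidean_space, 'm2, 'e2::euclidean_space) sector \<Rightarrow>
     ('z, 'l, 'n3::euclidean_space, 'm3, 'e3::euclidean_space) sector \<Rightarrow> bool" where
  "contextual \<Lambda> \<E> \<T> \<P> \<longleftrightarrow>
     \<not> (noncontextual_sector \<Lambda> \<E> \<and> noncontextual_sector (\<Lambda> \<times> \<Lambda>) \<T> \<and> noncontextual_sector \<Lambda> \<P>)"

definition exhibits_monodromy ::
    "'l set \<Rightarrow>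
     ('x, 'l, 'n1::euclidean_space, 'm1, 'e1::euclidean_space) sector \<Rightarrow>
     ('y, 'l \<times> 'l, 'n2::euclidean_space, 'm2, 'e2::euclidean_space) sector \<Rightarrow>
     ('z, 'l, 'n3::euclidean_space, 'm3, 'e3::euclidean_space) sector \<Rightarrow> bool" where
  "exhibits_monodromy \<Lambda> \<E> \<T> \<P> \<longleftrightarrow>
     monodromy_sector \<Lambda> \<E> \<or> monodromy_sector (\<Lambda> \<times> \<Lambda>) \<T> \<or> monodromy_sector \<Lambda> \<P>"

end

theory Submission
  imports Defs
begin

text \<open>On a loop the exact part \<open>dc\<close> of a valuation \<open>v = dc + \<omega>\<close> contributes nothing, so the phases of
  \<open>v\<close> and \<open>\<omega>\<close> agree; on a boundary the phase of a flat connection vanishes by Stokes' theorem. Hence a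
  loop with non-zero phase is never a boundary. Stokes' theorem for a smooth singular 2-simplex is
  obtained by pulling back along \<open>(s, u) \<mapsto> (s (1 - u), s u)\<close> from the unit square: with \<open>\<alpha>\<close>, \<open>\<beta>\<close> the
  components of the pulled-back form, closedness reads \<open>\<partial>\<alpha>/\<partial>u = \<partial>\<beta>/\<partial>s\<close>, so differentiating \<open>\<integral> \<alpha> ds\<close> under
  the integral sign leaves only boundary terms of \<open>\<beta>\<close>.\<close>

section \<open>Functions of class C-k\<close>

text \<open>A square has constant limits of integration, so Stokes' theorem reduces to the
  fundamental theorem of calculus and the Leibniz rule. The price is that the edge s = 0 collapses
  to vertex 0, where the form integrates to 0; the other three edges run along the three faces. The
  obstacle is locality: the image of a smooth simplex need not fit into one chart, and the simplex
  extends smoothly beyond its closed domain only near each point. Hence the pulled-back components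
  are defined through the integrand of the line integral, without fixing a chart, and their
  derivatives and continuity are checked locally. Closedness survives the pullback because second
  derivatives of the parametrisation commute, which is why a symmetry theorem for C^2 maps is
  derived. Since \<open>Ck\<close> controls derivatives, and a form its components, only for fixed
  vectors, vectors that vary with the point are expanded in the basis throughout. In the discrete
  case d is by definition dual to the boundary, so the analysis concerns only the continuous
  case.\<close>

lemma Ck_cong:
  assumes "open S" "\<And>x. x \<in> S \<Longrightarrow> f x = g x" "Ck k S f"
  shows "Ck k S g"
  using assms(2,3)
proof (induction k arbitrary: f g)
  case 0
  then show ?case by (auto cong: continuous_on_cong)
next
  case (Suc k)
  have der: "(g has_derivative frechet_derivative f (at x)) (at x)" if "x \<in> S" for x
    using Suc.prems that assms(1)
    by (auto simp: frechet_derivative_works intro: has_derivative_transform_within_open)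
  have eq: "frechet_derivative g (at x) = frechet_derivative f (at x)" if "x \<in> S" for x
    using frechet_derivative_at[OF der[OF that]] by simp
  have "Ck k S (\<lambda>x. frechet_derivative g (at x) v)" for v
    using Suc.IH[of "\<lambda>x. frechet_derivative f (at x) v" "\<lambda>x. frechet_derivative g (at x) v"]
      Suc.prems eq by simp
  then show ?case using der by (auto simp: differentiable_def)
qed

text \<open>Derivatives are unique, so any explicit formula \<open>f'\<close> may stand in for
  \<open>frechet_derivative\<close>; the closure properties below rely on this.\<close>

lemma Ck_SucI:
  assumes "open S" "\<And>x. x \<in> S \<Longrightarrow> (f has_derivative f' x) (at x)" "\<And>v. Ck k S (\<lambda>x. f' x v)"
  shows "Ck (Suc k) S f"
proof -
  have "f' x = frechet_derivative f (at x)" if "x \<in> S" for x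
    using frechet_derivative_at[OF assms(2)[OF that]] by simp
  then have "Ck k S (\<lambda>x. frechet_derivative f (at x) v)" for v
    by (intro Ck_cong[OF assms(1) _ assms(3)[of v]]) auto
  then show ?thesis using assms(2) by (auto simp: differentiable_def)
qed

lemma Ck_SucD:
  assumes "Ck (Suc k) S f"
  shows "x \<in> S \<Longrightarrow> (f has_derivative frechet_derivative f (at x)) (at x)"
    and "Ck k S (\<lambda>x. frechet_derivative f (at x) v)"
  using assms by (auto simp: frechet_derivative_works)

lemma Ck_subset:
  assumes "Ck k S f" "T \<subseteq> S"
  shows "Ck k T f"
  using assms by (induction k arbitrary: f) (auto intro: continuous_on_subset)

lemma Ck_Suc_imp: "Ck (Suc k) S f \<Longrightarrow> Ck k S f"
proof (induction k arbitrary: f)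
  case 0
  then show ?case
    by (auto intro!: continuous_at_imp_continuous_on differentiable_imp_continuous_within)
next
  case (Suc k)
  show ?case unfolding Ck.simps(2)[of k]
    using Suc.prems Suc.IH by (simp only: Ck.simps(2)[of "Suc k"]) blast
qed

lemma Ck_imp_continuous_on: "Ck k S f \<Longrightarrow> continuous_on S f"
  by (induction k) (auto dest: Ck_Suc_imp simp del: Ck.simps(2))

lemma Ck_const: "open S \<Longrightarrow> Ck k S (\<lambda>x. c)"
proof (induction k arbitrary: c)
  case (Suc k)
  then show ?case by (intro Ck_SucI[where f' = "\<lambda>_ _. 0"]) auto
qed simp

lemma Ck_bounded_linear:
  assumes "open S" "bounded_linear f"
  shows "Ck k S f"
  using assms
  by (cases k) (auto intro!: Ck_SucI Ck_const bounded_linear_imp_has_derivative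
      linear_continuous_on simp del: Ck.simps(2))

lemma Ck_add:
  assumes "open S" "Ck k S f" "Ck k S g"
  shows "Ck k S (\<lambda>x. f x + g x)"
  using assms(2,3)
proof (induction k arbitrary: f g)
  case 0
  then show ?case by (auto intro: continuous_on_add)
next
  case (Suc k)
  show ?case
    by (rule Ck_SucI[OF assms(1) has_derivative_add[OF Ck_SucD(1)[OF Suc.prems(1)] Ck_SucD(1)[OF Suc.prems(2)]]
          Suc.IH[OF Ck_SucD(2)[OF Suc.prems(1)] Ck_SucD(2)[OF Suc.prems(2)]]])
qed

lemma Ck_sum:
  assumes "open S" "finite I" "\<And>i. i \<in> I \<Longrightarrow> Ck k S (f i)"
  shows "Ck k S (\<lambda>x. \<Sum>i\<in>I. f i x)"
  using assms(2,3)
  by (induction I rule: finite_induct) (auto intro!: Ck_add Ck_const assms(1))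

text \<open>One Leibniz rule for scalar multiplication, multiplication and inner product alike. Each
  summand keeps one factor undifferentiated, which is lowered from \<open>Suc k\<close> to
  \<open>k\<close> by \<open>Ck_Suc_imp\<close> before the induction hypothesis applies.\<close>

lemma (in bounded_bilinear) Ck_prod:
  assumes "open S" "Ck k S f" "Ck k S g"
  shows "Ck k S (\<lambda>x. prod (f x) (g x))"
  using assms(2,3)
proof (induction k arbitrary: f g)
  case 0
  then show ?case by (auto intro: continuous_on)
next
  case (Suc k)
  show ?case
    by (rule Ck_SucI[OF assms(1) FDERIV[OF Ck_SucD(1)[OF Suc.prems(1)] Ck_SucD(1)[OF Suc.prems(2)]]],
       assumption, assumption,
       intro Ck_add[OF assms(1)] Suc.IH Ck_Suc_imp[OF Suc.prems(1)] Ck_Suc_imp[OF Suc.prems(2)]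
         Ck_SucD(2)[OF Suc.prems(1)] Ck_SucD(2)[OF Suc.prems(2)])
qed

text \<open>Turns a linear map applied to a moving vector into a sum of products that involve its
  values on fixed vectors only.\<close>

lemma linear_basis_expansion:
  fixes f :: "'a::euclidean_space \<Rightarrow> 'b::real_vector"
  assumes "linear f"
  shows "f v = (\<Sum>b\<in>Basis. (v \<bullet> b) *\<^sub>R f b)"
proof -
  have "f v = f (\<Sum>b\<in>Basis. (v \<bullet> b) *\<^sub>R b)" by (simp add: euclidean_representation)
  also have "\<dots> = (\<Sum>b\<in>Basis. (v \<bullet> b) *\<^sub>R f b)"
    by (simp add: linear_sum[OF assms] linear_scale[OF assms])
  finally show ?thesis .
qed

text \<open>The chain rule yields f'(g x)(g'(x) v), whose argument moves with x, whereas the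
  hypothesis on f concerns f' in fixed directions. Expanded in \<open>Basis\<close> it becomes a sum
  of products, each covered by the induction hypothesis and the Leibniz rule.\<close>

lemma Ck_compose:
  fixes g :: "'a::euclidean_space \<Rightarrow> 'b::euclidean_space"
  assumes "open S" "Ck k T f" "Ck k S g" "g ` S \<subseteq> T"
  shows "Ck k S (\<lambda>x. f (g x))"
  using assms(2,3)
proof (induction k arbitrary: f)
  case 0
  then show ?case using assms(4) by (auto intro: continuous_on_compose2)
next
  case (Suc k)
  let ?f' = "\<lambda>x. frechet_derivative f (at x)" and ?g' = "\<lambda>x. frechet_derivative g (at x)"
  have der: "((\<lambda>x. f (g x)) has_derivative (\<lambda>v. \<Sum>b\<in>Basis. (?g' x v \<bullet> b) *\<^sub>R ?f' (g x) b)) (at x)"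
    if "x \<in> S" for x
  proof -
    have f': "(f has_derivative ?f' (g x)) (at (g x))"
      using Ck_SucD(1)[OF Suc.prems(1)] assms(4) that by auto
    have "((\<lambda>x. f (g x)) has_derivative (\<lambda>v. ?f' (g x) (?g' x v))) (at x)"
      by (rule has_derivative_compose[OF Ck_SucD(1)[OF Suc.prems(2) that] f'])
    moreover have "(\<lambda>v. ?f' (g x) (?g' x v)) = (\<lambda>v. \<Sum>b\<in>Basis. (?g' x v \<bullet> b) *\<^sub>R ?f' (g x) b)"
      by (rule ext) (rule linear_basis_expansion[OF has_derivative_linear[OF f']])
    ultimately show ?thesis by simp
  qed
  show ?case
    by (intro Ck_SucI[OF assms(1) der] Ck_sum assms(1) finite_Basis
        bounded_bilinear.Ck_prod[OF bounded_bilinear_scaleR]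
        bounded_bilinear.Ck_prod[OF bounded_bilinear_inner] Ck_const
        Ck_SucD(2)[OF Suc.prems(2)] Suc.IH Ck_SucD(2)[OF Suc.prems(1)] Ck_Suc_imp[OF Suc.prems(2)])
qed

section \<open>Mixed partial derivatives and Green's theorem on the square\<close>

lemma has_vector_derivative_fst:
  assumes "(f has_derivative f') (at (s, u))"
  shows "((\<lambda>s. f (s, u)) has_vector_derivative f' (1, 0)) (at s within X)"
proof -
  have "((\<lambda>s. f (s, u)) has_derivative (\<lambda>t. f' (t, 0))) (at s)"
    by (rule has_derivative_compose[where f = "\<lambda>s. (s, u)", OF _ assms]) (auto intro!: derivative_eq_intros)
  moreover have "(\<lambda>t. f' (t, 0)) = (\<lambda>t. t *\<^sub>R f' (1, 0))"
  proof
    show "f' (t, 0) = t *\<^sub>R f' (1, 0)" for t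
      using linear_scale[OF has_derivative_linear[OF assms], of t "(1, 0)"] by simp
  qed
  ultimately show ?thesis
    by (simp add: has_vector_derivative_def has_derivative_at_withinI)
qed

lemma has_vector_derivative_snd:
  assumes "(f has_derivative f') (at (s, u))"
  shows "((\<lambda>u. f (s, u)) has_vector_derivative f' (0, 1)) (at u within X)"
proof -
  have "((\<lambda>u. f (s, u)) has_derivative (\<lambda>t. f' (0, t))) (at u)"
    by (rule has_derivative_compose[where f = "\<lambda>u. (s, u)", OF _ assms]) (auto intro!: derivative_eq_intros)
  moreover have "(\<lambda>t. f' (0, t)) = (\<lambda>t. t *\<^sub>R f' (0, 1))"
  proof
    show "f' (0, t) = t *\<^sub>R f' (0, 1)" for t
      using linear_scale[OF has_derivative_linear[OF assms], of t "(0, 1)"] by simp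
  qed
  ultimately show ?thesis
    by (simp add: has_vector_derivative_def has_derivative_at_withinI)
qed

text \<open>Integrate the partial derivative in \<open>u\<close>, differentiate under the integral sign in \<open>s\<close>, and
  differentiate the result in \<open>u\<close>.\<close>

lemma mixed_partials_eq:
  fixes f :: "real \<times> real \<Rightarrow> 'b::banach"
  assumes "open N" "(s0, u0) \<in> N"
    and fs: "\<And>s u. (s, u) \<in> N \<Longrightarrow> ((\<lambda>s. f (s, u)) has_vector_derivative fs (s, u)) (at s)"
    and fu: "\<And>s u. (s, u) \<in> N \<Longrightarrow> ((\<lambda>u. f (s, u)) has_vector_derivative fu (s, u)) (at u)"
    and fsu: "((\<lambda>u. fs (s0, u)) has_vector_derivative d) (at u0)"
    and fus: "\<And>s u. (s, u) \<in> N \<Longrightarrow> ((\<lambda>s. fu (s, u)) has_vector_derivative fus (s, u)) (at s)"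
    and cont: "continuous_on N fu" "continuous_on N fus"
  shows "fus (s0, u0) = d"
proof -
  obtain S T where ST: "open S" "open T" "s0 \<in> S" "u0 \<in> T" "S \<times> T \<subseteq> N"
    using open_prod_elim[OF assms(1,2)] by (metis mem_Sigma_iff)
  obtain e1 where e1: "e1 > 0" "cball s0 e1 \<subseteq> S" using ST open_contains_cball by blast
  obtain e2 where e2: "e2 > 0" "cball u0 e2 \<subseteq> T" using ST open_contains_cball by blast
  define a b where "a = u0 - e2" and "b = u0 + e2"
  have ab: "a < u0" "u0 < b" using e2 by (auto simp: a_def b_def)
  have inN: "(s, u) \<in> N" if "s \<in> cball s0 e1" "u \<in> {a..b}" for s u
    using that e1 e2 ST by (auto simp: a_def b_def subset_eq dist_real_def)
  have s0: "s0 \<in> cball s0 e1" using e1 by simp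
  have fu_int: "(fu \<circ> Pair s) integrable_on cbox a u" if "s \<in> cball s0 e1" "u \<in> {a..b}" for s u
    using that inN
    by (intro integrable_continuous continuous_on_compose continuous_intros
        continuous_on_subset[OF cont(1)]) auto
  \<comment> \<open>Both sides are the derivative at \<open>s0\<close> of f (s, u) - f (s, a): once
    as the integral of \<open>fu\<close> over [a, u], once directly.\<close>
  have eq: "integral {a..u} (\<lambda>v. fus (s0, v)) = fs (s0, u) - fs (s0, a)" if u: "u \<in> {a..b}" for u
  proof -
    have ftc: "integral (cbox a u) (\<lambda>v. fu (s, v)) = f (s, u) - f (s, a)" if "s \<in> cball s0 e1" for s
      using that u inN
      by (intro integral_unique, unfold box_real, intro fundamental_theorem_of_calculus)
         (auto intro!: has_vector_derivative_at_within[OF fu])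
    have "((\<lambda>s. integral (cbox a u) (\<lambda>v. fu (s, v))) has_vector_derivative
        integral (cbox a u) (\<lambda>v. fus (s0, v))) (at s0 within cball s0 e1)"
    proof (rule leibniz_rule_vector_derivative)
      show "continuous_on (cball s0 e1 \<times> cbox a u) (\<lambda>(s, v). fus (s, v))"
        using u inN by (auto intro!: continuous_on_subset[OF cont(2)] simp: split_def)
      show "(\<lambda>v. fu (s, v)) integrable_on cbox a u" if "s \<in> cball s0 e1" for s
        using fu_int[OF that u] by (simp add: o_def)
    qed (use s0 u inN in \<open>auto intro!: has_vector_derivative_at_within[OF fus]\<close>)
    then have 1: "((\<lambda>s. f (s, u) - f (s, a)) has_vector_derivative
        integral (cbox a u) (\<lambda>v. fus (s0, v))) (at s0 within cball s0 e1)"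
      by (rule has_vector_derivative_transform[OF s0, rotated]) (simp only: ftc)
    have 2: "((\<lambda>s. f (s, u) - f (s, a)) has_vector_derivative fs (s0, u) - fs (s0, a))
        (at s0)"
      using u s0 inN ab by (intro has_vector_derivative_diff fs) auto
    have "at s0 within cball s0 e1 = at s0"
      using e1 by (intro at_within_interior) (simp add: interior_cball)
    with 1 have "((\<lambda>s. f (s, u) - f (s, a)) has_vector_derivative
        integral (cbox a u) (\<lambda>v. fus (s0, v))) (at s0)" by simp
    from vector_derivative_unique_at[OF this 2] show ?thesis by simp
  qed
  have "continuous_on {a..b} (\<lambda>v. fus (s0, v))"
    using s0 inN by (intro continuous_on_compose2[OF cont(2)] continuous_intros) auto
  from integral_has_vector_derivative[OF this, of u0] ab
  have "((\<lambda>u. integral {a..u} (\<lambda>v. fus (s0, v))) has_vector_derivative fus (s0, u0)) (at u0 within {a..b})"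
    by auto
  then have "((\<lambda>u. fs (s0, u) - fs (s0, a)) has_vector_derivative fus (s0, u0)) (at u0 within {a..b})"
    using ab by (intro has_vector_derivative_transform[of _ _ "\<lambda>u. fs (s0, u) - fs (s0, a)"]) (auto simp: eq)
  moreover have "at u0 within {a..b} = at u0"
    using ab by (intro at_within_interior) simp
  ultimately have 3: "((\<lambda>u. fs (s0, u) - fs (s0, a)) has_vector_derivative fus (s0, u0)) (at u0)"
    by simp
  have "((\<lambda>u. fs (s0, u) - fs (s0, a)) has_vector_derivative d) (at u0)"
    using has_vector_derivative_diff[OF fsu has_vector_derivative_const[of "fs (s0, a)"]] by simp
  from vector_derivative_unique_at[OF 3 this] show ?thesis .
qed

text \<open>The partial derivatives are the directional ones along (1, 0) and (0, 1). This symmetry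
  cancels the second-order terms when a form is pulled back along \<open>g\<close>.\<close>

lemma Ck_2_symmetric:
  fixes g :: "real \<times> real \<Rightarrow> 'b::banach"
  assumes "open N" "Ck 2 N g" "z \<in> N"
  shows "frechet_derivative (\<lambda>z. frechet_derivative g (at z) (0, 1)) (at z) (1, 0) =
    frechet_derivative (\<lambda>z. frechet_derivative g (at z) (1, 0)) (at z) (0, 1)"
proof -
  obtain s0 u0 where z: "z = (s0, u0)" by (cases z)
  have C2: "Ck (Suc 1) N g" using assms(2) by (simp only: Suc_1)
  have C1: "Ck (Suc 0) N (\<lambda>z. frechet_derivative g (at z) v)" for v
    using Ck_SucD(2)[OF C2] by simp
  show ?thesis unfolding z
  proof (rule mixed_partials_eq[OF assms(1), of _ _ g "\<lambda>z. frechet_derivative g (at z) (1, 0)"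
        "\<lambda>z. frechet_derivative g (at z) (0, 1)" _
        "\<lambda>z. frechet_derivative (\<lambda>z. frechet_derivative g (at z) (0, 1)) (at z) (1, 0)"])
    show "continuous_on N (\<lambda>z. frechet_derivative g (at z) (0, 1))"
      using C1 by (rule Ck_imp_continuous_on)
    show "continuous_on N (\<lambda>z. frechet_derivative (\<lambda>z. frechet_derivative g (at z) (0, 1)) (at z) (1, 0))"
      by (rule Ck_imp_continuous_on[OF Ck_SucD(2)[OF C1]])
  qed (use assms(3) z in \<open>auto intro!: has_vector_derivative_fst has_vector_derivative_snd
    Ck_SucD(1)[OF C2] Ck_SucD(1)[OF C1]\<close>)
qed

text \<open>The common derivative \<open>\<delta>\<close> encodes that \<alpha> ds + \<beta> du is
  closed. Derivatives are taken within \<open>{0..1}\<close> because the components will be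
  meaningful on the closed square only.\<close>

lemma green_unit_square:
  fixes \<alpha> \<beta> \<delta> :: "real \<times> real \<Rightarrow> 'b::banach"
  assumes \<alpha>: "\<And>s u. s \<in> {0..1} \<Longrightarrow> u \<in> {0..1} \<Longrightarrow>
      ((\<lambda>u. \<alpha> (s, u)) has_vector_derivative \<delta> (s, u)) (at u within {0..1})"
    and \<beta>: "\<And>s u. s \<in> {0..1} \<Longrightarrow> u \<in> {0..1} \<Longrightarrow>
      ((\<lambda>s. \<beta> (s, u)) has_vector_derivative \<delta> (s, u)) (at s within {0..1})"
    and cont: "continuous_on ({0..1} \<times> {0..1}) \<alpha>" "continuous_on ({0..1} \<times> {0..1}) \<beta>"
      "continuous_on ({0..1} \<times> {0..1}) \<delta>"
  shows "integral {0..1} (\<lambda>s. \<alpha> (s, 1)) - integral {0..1} (\<lambda>s. \<alpha> (s, 0)) =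
    integral {0..1} (\<lambda>u. \<beta> (1, u)) - integral {0..1} (\<lambda>u. \<beta> (0, u))"
proof -
  have 1: "((\<lambda>u. integral (cbox 0 1) (\<lambda>s. \<alpha> (s, u))) has_vector_derivative
      integral (cbox 0 1) (\<lambda>s. \<delta> (s, u))) (at u within {0..1})" if "u \<in> {0..1}" for u
  proof (rule leibniz_rule_vector_derivative[OF _ _ _ that])
    show "(\<lambda>s. \<alpha> (s, u)) integrable_on cbox 0 1" if "u \<in> {0..1}" for u
      using that by (intro integrable_continuous continuous_on_compose2[OF cont(1)] continuous_intros) auto
    have "continuous_on ({0..1} \<times> {0..1}) (\<lambda>z. \<delta> (snd z, fst z))"
      by (intro continuous_on_compose2[OF cont(3)] continuous_intros) auto
    then show "continuous_on ({0..1} \<times> cbox 0 1) (\<lambda>(u, s). \<delta> (s, u))"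
      by (simp add: split_def)
  qed (use \<alpha> in auto)
  have 2: "integral (cbox 0 1) (\<lambda>s. \<delta> (s, u)) = \<beta> (1, u) - \<beta> (0, u)" if "u \<in> {0..1}" for u
    unfolding box_real using \<beta> that by (intro integral_unique fundamental_theorem_of_calculus) auto
  \<comment> \<open>By the two facts above, the integral of \<alpha> over s is an antiderivative in
    u of this difference.\<close>
  have "((\<lambda>u. \<beta> (1, u) - \<beta> (0, u)) has_integral
      integral (cbox 0 1) (\<lambda>s. \<alpha> (s, 1)) - integral (cbox 0 1) (\<lambda>s. \<alpha> (s, 0))) {0..1}"
    by (rule fundamental_theorem_of_calculus) (use 1 2 in \<open>auto simp flip: 2\<close>)
  then have "integral {0..1} (\<lambda>u. \<beta> (1, u) - \<beta> (0, u)) =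
      integral (cbox 0 1) (\<lambda>s. \<alpha> (s, 1)) - integral (cbox 0 1) (\<lambda>s. \<alpha> (s, 0))"
    by (rule integral_unique)
  moreover have "(\<lambda>u. \<beta> (i, u)) integrable_on {0..1}" if "i \<in> {0..1}" for i
    using that by (intro integrable_continuous_real continuous_on_compose2[OF cont(2)] continuous_intros) auto
  ultimately show ?thesis by (simp add: integral_diff)
qed

text \<open>Here \<open>a x v\<close> is a 1-form in coordinates, and \<open>closed\<close> says
  that its derivative is symmetric in slot and direction. Differentiating the pulled-back component
  gives a term with the derivative of \<open>a\<close>, symmetric by closedness, and a term with the
  second derivative of \<open>g\<close>, symmetric by \<open>Ck_2_symmetric\<close>.\<close>

lemma closed_form_pullback:
  fixes g :: "real \<times> real \<Rightarrow> 'e::euclidean_space" and a :: "'e \<Rightarrow> 'e \<Rightarrow> real"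
  assumes N: "open N" "Ck 2 N g" and g: "g ` N \<subseteq> V"
    and a: "\<And>v. Ck 1 V (\<lambda>x. a x v)" "\<And>x. x \<in> V \<Longrightarrow> linear (a x)"
    and closed: "\<And>x v w. x \<in> V \<Longrightarrow>
      frechet_derivative (\<lambda>x. a x v) (at x) w = frechet_derivative (\<lambda>x. a x w) (at x) v"
  shows "Ck 1 N (\<lambda>z. a (g z) (frechet_derivative g (at z) v))"
    and "z \<in> N \<Longrightarrow>
      frechet_derivative (\<lambda>z. a (g z) (frechet_derivative g (at z) (1, 0))) (at z) (0, 1) =
      frechet_derivative (\<lambda>z. a (g z) (frechet_derivative g (at z) (0, 1))) (at z) (1, 0)"
proof -
  let ?g' = "\<lambda>v z. frechet_derivative g (at z) v"
  let ?D = "\<lambda>f x. frechet_derivative f (at x)"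
  have C2: "Ck (Suc 1) N g" using N(2) by (simp only: Suc_1)
  have C1: "Ck 1 N (?g' v)" for v
    using Ck_SucD(2)[OF C2] by simp
  have exp: "a (g z) v = (\<Sum>b\<in>Basis. (v \<bullet> b) * a (g z) b)" if "z \<in> N" for z v
    using linear_basis_expansion[OF a(2), of "g z" v] that g by auto
  have "Ck 1 N (\<lambda>z. \<Sum>b\<in>Basis. (?g' v z \<bullet> b) * a (g z) b)" for v
    by (intro Ck_sum N(1) finite_Basis bounded_bilinear.Ck_prod[OF bounded_bilinear_mult]
        bounded_bilinear.Ck_prod[OF bounded_bilinear_inner] Ck_const C1
        Ck_compose[OF N(1) a(1) _ g] Ck_Suc_imp[OF C2])
  then show "Ck 1 N (\<lambda>z. a (g z) (?g' v z))" for v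
    by (rule Ck_cong[OF N(1), rotated]) (rule exp[symmetric])
  have a': "((\<lambda>x. a x v) has_derivative ?D (\<lambda>x. a x v) x) (at x)" if "x \<in> V" for x v
    using Ck_SucD(1)[of 0 V "\<lambda>x. a x v"] a(1) that by simp
  \<comment> \<open>Closedness trades the slot \<open>b\<close> for the direction \<open>w\<close>;
    the derivative is linear in its direction, so the sum over the basis collapses.\<close>
  have lin: "(\<Sum>b\<in>Basis. (v \<bullet> b) * ?D (\<lambda>x. a x b) (g z) w) = ?D (\<lambda>x. a x w) (g z) v" if "z \<in> N" for z v w
  proof -
    have gz: "g z \<in> V" using that g by auto
    show ?thesis
      using linear_basis_expansion[OF has_derivative_linear[OF a'[OF gz, of w]], of v]
      by (simp add: closed[OF gz, of _ w])
  qed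
  \<comment> \<open>In the first summand the vector \<open>?g' w z\<close> in the slot is frozen
    while \<open>a\<close> is differentiated; \<open>lin\<close> has already exchanged the roles of
    \<open>v\<close> and \<open>w\<close> there.\<close>
  have D: "?D (\<lambda>z. a (g z) (?g' v z)) z w =
      ?D (\<lambda>x. a x (?g' w z)) (g z) (?g' v z) + a (g z) (?D (?g' v) z w)" if z: "z \<in> N" for z v w
  proof -
    have g'': "(?g' v has_derivative ?D (?g' v) z) (at z)"
      using Ck_SucD(1)[of 0 N "?g' v"] C1 z by simp
    have gz: "g z \<in> V" using z g by auto
    have "((\<lambda>z. \<Sum>b\<in>Basis. (?g' v z \<bullet> b) * a (g z) b) has_derivative
        (\<lambda>w. \<Sum>b\<in>Basis. (?g' v z \<bullet> b) * ?D (\<lambda>x. a x b) (g z) (?g' w z) + (?D (?g' v) z w \<bullet> b) * a (g z) b)) (at z)"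
      by (intro has_derivative_sum has_derivative_mult has_derivative_inner_left g''
          has_derivative_compose[OF Ck_SucD(1)[OF C2 z] a'[OF gz]])
    then have "((\<lambda>z. a (g z) (?g' v z)) has_derivative
        (\<lambda>w. \<Sum>b\<in>Basis. (?g' v z \<bullet> b) * ?D (\<lambda>x. a x b) (g z) (?g' w z) + (?D (?g' v) z w \<bullet> b) * a (g z) b)) (at z)"
      by (rule has_derivative_transform_within_open[OF _ N(1) z]) (rule exp[symmetric])
    from frechet_derivative_at[OF this, symmetric] show ?thesis
      by (simp add: sum.distrib lin[OF z] flip: exp[OF z])
  qed
  assume z: "z \<in> N"
  show "?D (\<lambda>z. a (g z) (?g' (1, 0) z)) z (0, 1) = ?D (\<lambda>z. a (g z) (?g' (0, 1) z)) z (1, 0)"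
    using z g by (subst (1 2) D[OF z])
      (simp add: Ck_2_symmetric[OF N z] closed[of "g z" "?g' (0, 1) z" "?g' (1, 0) z"] subset_eq)
qed

section \<open>Passing from local extensions to functions on a closed domain\<close>

lemma has_vector_derivative_transform_nbhd:
  assumes "(f has_vector_derivative d) (at x within S)" "open N" "x \<in> N" "x \<in> S"
    and "\<And>y. y \<in> N \<inter> S \<Longrightarrow> f y = g y"
  shows "(g has_vector_derivative d) (at x within S)"
proof -
  have "\<forall>\<^sub>F y in at x within S. f y = g y"
    using assms(2,3,5) by (auto simp: eventually_at_topological)
  then show ?thesis
    using assms unfolding has_vector_derivative_def
    by (intro has_derivative_transform_eventually[of f _ x S g]) auto
qed

text \<open>The continuous extension may change from point to point and agrees with \<open>f\<close>
  only inside \<open>S\<close>, which is what charts provide near the edges of the square.\<close>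

lemma continuous_on_locally:
  fixes f :: "'a::t2_space \<Rightarrow> 'b::topological_space"
  assumes "\<And>x. x \<in> S \<Longrightarrow> \<exists>N g. open N \<and> x \<in> N \<and> continuous_on N g \<and> (\<forall>y\<in>N \<inter> S. f y = g y)"
  shows "continuous_on S f"
proof -
  have "continuous (at x within S) f" if x: "x \<in> S" for x
  proof -
    obtain N g where N: "open N" "x \<in> N" "continuous_on N g" "\<And>y. y \<in> N \<inter> S \<Longrightarrow> f y = g y"
      using assms[OF x] by blast
    have "continuous_on (S \<inter> N) f"
      by (rule continuous_on_eq[OF continuous_on_subset[OF N(3)]]) (use N(4) in auto)
    then have "continuous (at x within S \<inter> N) f"
      using x N(2) by (auto simp: continuous_on_eq_continuous_within)
    moreover have "at x within S \<inter> N = at x within S"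
      using N(1,2) by (intro at_within_nhd[of x N]) auto
    ultimately show ?thesis by simp
  qed
  then show ?thesis by (simp add: continuous_on_eq_continuous_within)
qed

section \<open>Integrating forms along curves\<close>

text \<open>The integrand of \<open>line_integral\<close>, detached from singular simplices so that
  it also makes sense along every horizontal and vertical line of a square.\<close>

definition form_along ::
    "('m, 'e::euclidean_space) chart set \<Rightarrow> ('n, 'm, 'e) form \<Rightarrow> (real \<Rightarrow> 'm) \<Rightarrow> real \<Rightarrow> real" where
  "form_along A w c t =
     (let ch = (SOME ch. ch \<in> A \<and> c t \<in> fst ch)
      in w (Frame ch (c t) [vector_derivative (\<lambda>s. snd ch (c s)) (at t within {0..1})]))"

lemma line_integral_eq_form_along:
  "line_integral A w \<sigma> = integral {0..1} (form_along A w (\<sigma> \<circ> segment_point))"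
  by (simp add: line_integral_def form_along_def[abs_def] o_def Let_def)

lemma form_along_cong:
  assumes "\<And>s. s \<in> {0..1} \<Longrightarrow> c s = c' s" "t \<in> {0..1}"
  shows "form_along A w c t = form_along A w c' t"
proof -
  have "vector_derivative (\<lambda>s. f (c s)) (at t within {0..1}) =
      vector_derivative (\<lambda>s. f (c' s)) (at t within {0..1})" for f :: "'a \<Rightarrow> 'b"
    using assms by (intro vector_derivative_cong_eq) auto
  then show ?thesis using assms by (simp add: form_along_def)
qed

text \<open>A 0-form is a function on the manifold, but it is stored chart by chart with an empty
  frame. This recovers the function; by \<open>eval_at_eq\<close> the choice of chart is
  immaterial.\<close>

definition eval_at :: "('m, 'e::euclidean_space) chart set \<Rightarrow> ('n, 'm, 'e) form \<Rightarrow> 'm \<Rightarrow> real" where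
  "eval_at A f p = f (Frame (SOME ch. ch \<in> A \<and> p \<in> fst ch) p [])"

text \<open>Both definitions require only local extensions across the boundary of the domain, which is
  what smoothness of a singular simplex provides.\<close>

definition smooth_curve :: "('m, 'e::euclidean_space) chart set \<Rightarrow> (real \<Rightarrow> 'm) \<Rightarrow> bool" where
  "smooth_curve A c \<longleftrightarrow> (\<forall>t\<in>{0..1}. \<exists>(U, \<phi>)\<in>A. \<exists>N g g'. open N \<and> t \<in> N \<and>
     (\<forall>s\<in>N. (g has_vector_derivative g' s) (at s)) \<and> continuous_on N g' \<and> g ` N \<subseteq> \<phi> ` U \<and>
     (\<forall>s\<in>N \<inter> {0..1}. c s \<in> U \<and> g s = \<phi> (c s)))"

definition smooth_square :: "('m, 'e::euclidean_space) chart set \<Rightarrow> (real \<times> real \<Rightarrow> 'm) \<Rightarrow> bool" where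
  "smooth_square A F \<longleftrightarrow> (\<forall>z\<in>{0..1} \<times> {0..1}. \<exists>(U, \<phi>)\<in>A. \<exists>N g. open N \<and> z \<in> N \<and>
     Ck 2 N g \<and> g ` N \<subseteq> \<phi> ` U \<and>
     (\<forall>y\<in>N \<inter> {0..1} \<times> {0..1}. F y \<in> U \<and> g y = \<phi> (F y)))"

lemma smooth_curveE:
  assumes "smooth_curve A c" "t \<in> {0..1}"
  obtains U \<phi> N g g' where "(U, \<phi>) \<in> A" "open N" "t \<in> N"
    "\<forall>s\<in>N. (g has_vector_derivative g' s) (at s)" "continuous_on N g'" "g ` N \<subseteq> \<phi> ` U"
    "\<forall>s\<in>N \<inter> {0..1}. c s \<in> U \<and> g s = \<phi> (c s)"
proof -
  from bspec[OF assms(1)[unfolded smooth_curve_def] assms(2)]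
  obtain U \<phi> N g g' where "(U, \<phi>) \<in> A" and *: "open N \<and> t \<in> N \<and>
     (\<forall>s\<in>N. (g has_vector_derivative g' s) (at s)) \<and> continuous_on N g' \<and> g ` N \<subseteq> \<phi> ` U \<and>
     (\<forall>s\<in>N \<inter> {0..1}. c s \<in> U \<and> g s = \<phi> (c s))"
    by blast
  from this(1) show thesis by (rule that[of U \<phi> N g g']) (use * in auto)
qed

lemma smooth_squareE:
  assumes "smooth_square A F" "z \<in> {0..1} \<times> {0..1}"
  obtains U \<phi> N g where "(U, \<phi>) \<in> A" "open N" "z \<in> N" "Ck 2 N g" "g ` N \<subseteq> \<phi> ` U"
    "\<forall>y\<in>N \<inter> {0..1} \<times> {0..1}. F y \<in> U \<and> g y = \<phi> (F y)"
proof -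
  from bspec[OF assms(1)[unfolded smooth_square_def] assms(2)]
  obtain U \<phi> N g where "(U, \<phi>) \<in> A" and *: "open N \<and> z \<in> N \<and>
     Ck 2 N g \<and> g ` N \<subseteq> \<phi> ` U \<and>
     (\<forall>y\<in>N \<inter> {0..1} \<times> {0..1}. F y \<in> U \<and> g y = \<phi> (F y))"
    by blast
  from this(1) show thesis by (rule that[of U \<phi> N g]) (use * in auto)
qed

section \<open>Forms on a smooth manifold, computed in charts\<close>

context
  fixes X :: "'m topology" and A :: "('m, 'e::euclidean_space) chart set"
  assumes X: "smooth_manifold X A"
begin

lemma chart_homeomorphic:
  assumes "(U, \<phi>) \<in> A"
  shows "openin X U" "open (\<phi> ` U)" "homeomorphic_map (subtopology X U) (top_of_set (\<phi> ` U)) \<phi>"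
  using X assms by (auto simp: smooth_manifold_def)

lemma chart_inj:
  assumes "(U, \<phi>) \<in> A"
  shows "inj_on \<phi> U"
  using homeomorphic_imp_injective_map[OF chart_homeomorphic(3)[OF assms]]
    openin_subset[OF chart_homeomorphic(1)[OF assms]]
  by (simp add: Int_absorb1)

lemma chart_inv:
  assumes "(U, \<phi>) \<in> A"
  shows "p \<in> U \<Longrightarrow> inv_into U \<phi> (\<phi> p) = p"
  using chart_inj[OF assms] by simp

lemma has_derivative_transition:
  assumes "(U, \<phi>) \<in> A" "(V, \<psi>) \<in> A" "p \<in> U \<inter> V"
  shows "((\<psi> \<circ> inv_into U \<phi>) has_derivative
    frechet_derivative (\<psi> \<circ> inv_into U \<phi>) (at (\<phi> p))) (at (\<phi> p))"
proof -
  have "smooth_on (\<phi> ` (U \<inter> V)) (\<psi> \<circ> inv_into U \<phi>)"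
    using X assms(1,2) unfolding smooth_manifold_def by blast
  then have "Ck (Suc 0) (\<phi> ` (U \<inter> V)) (\<psi> \<circ> inv_into U \<phi>)"
    unfolding smooth_on_def by blast
  from Ck_SucD(1)[OF this] assms(3) show ?thesis by blast
qed

lemma some_chart:
  assumes "(U, \<phi>) \<in> A" "p \<in> U"
  obtains V \<psi> where "(SOME ch. ch \<in> A \<and> p \<in> fst ch) = (V, \<psi>)" "(V, \<psi>) \<in> A" "p \<in> V"
proof -
  have "\<exists>ch. ch \<in> A \<and> p \<in> fst ch" using assms by force
  from someI_ex[OF this] that show thesis by (cases "SOME ch. ch \<in> A \<and> p \<in> fst ch") auto
qed

lemma form_chart_change:
  fixes w :: "('n::euclidean_space, 'm, 'e) form"
  assumes w: "w \<in> forms (Continuous X A) n" and vs: "length vs = n"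
    and ch: "(U, \<phi>) \<in> A" "(V, \<psi>) \<in> A" "p \<in> U" "p \<in> V"
  shows "w (Frame (U, \<phi>) p vs) =
    w (Frame (V, \<psi>) p (map (frechet_derivative (\<psi> \<circ> inv_into U \<phi>) (at (\<phi> p))) vs))"
proof -
  have "\<forall>(U, \<phi>)\<in>A. \<forall>(V, \<psi>)\<in>A. \<forall>p\<in>U \<inter> V. \<forall>vs. length vs = n \<longrightarrow>
      w (Frame (U, \<phi>) p vs) =
      w (Frame (V, \<psi>) p (map (frechet_derivative (\<psi> \<circ> inv_into U \<phi>) (at (\<phi> p))) vs))"
    using w unfolding forms.simps mem_Collect_eq by (elim conjE)
  with vs ch show ?thesis by blast
qed

lemma one_form_linear:
  fixes w :: "('n::euclidean_space, 'm, 'e) form"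
  assumes w: "w \<in> forms (Continuous X A) 1" and ch: "(U, \<phi>) \<in> A" "p \<in> U"
  shows "linear (\<lambda>v. w (Frame (U, \<phi>) p [v]))"
proof -
  have "\<forall>(U, \<phi>)\<in>A. \<forall>p\<in>U. \<forall>vs. length vs = 1 \<longrightarrow>
        (\<forall>i<1. linear (\<lambda>v. w (Frame (U, \<phi>) p (vs[i := v])))) \<and>
        (\<not> distinct vs \<longrightarrow> w (Frame (U, \<phi>) p vs) = 0)"
    using w unfolding forms.simps mem_Collect_eq by (elim conjE)
  then have "\<forall>vs. length vs = 1 \<longrightarrow> (\<forall>i<1. linear (\<lambda>v. w (Frame (U, \<phi>) p (vs[i := v]))))"
    using ch by blast
  from this[rule_format, of "[0]" 0] show ?thesis by simp
qed

lemma form_smooth: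
  fixes w :: "('n::euclidean_space, 'm, 'e) form"
  assumes w: "w \<in> forms (Continuous X A) n" and ch: "(U, \<phi>) \<in> A" and n: "length vs = n"
  shows "Ck k (\<phi> ` U) (\<lambda>x. w (Frame (U, \<phi>) (inv_into U \<phi> x) vs))"
proof -
  have "\<forall>(U, \<phi>)\<in>A. \<forall>vs. length vs = n \<longrightarrow>
        smooth_on (\<phi> ` U) (\<lambda>x. w (Frame (U, \<phi>) (inv_into U \<phi> x) vs))"
    using w unfolding forms.simps mem_Collect_eq by (elim conjE)
  with ch n show ?thesis unfolding smooth_on_def by blast
qed

lemma eval_at_eq:
  fixes f :: "('n::euclidean_space, 'm, 'e) form"
  assumes f: "f \<in> forms (Continuous X A) 0" and ch: "(U, \<phi>) \<in> A" "p \<in> U"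
  shows "eval_at A f p = f (Frame (U, \<phi>) p [])"
proof -
  obtain V \<psi> where V: "(SOME ch. ch \<in> A \<and> p \<in> fst ch) = (V, \<psi>)" "(V, \<psi>) \<in> A" "p \<in> V"
    using some_chart[OF ch] .
  show ?thesis
    using form_chart_change[OF f _ ch(1) V(2) ch(2) V(3), of "[]"] by (simp add: eval_at_def V(1))
qed

text \<open>The derivative of the transition map carries the velocity read in \<open>\<phi>\<close>
  to the velocity read in the chart picked by \<open>SOME\<close>, and the transformation law of a
  1-form compensates exactly for this. So the integrand may be computed in any chart that contains
  the curve near \<open>t\<close>.\<close>

lemma form_along_eq:
  fixes w :: "('n::euclidean_space, 'm, 'e) form"
  assumes w: "w \<in> forms (Continuous X A) 1" and ch: "(U, \<phi>) \<in> A"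
    and N: "open N" "t \<in> N" "t \<in> {0..1}" "\<And>s. s \<in> N \<Longrightarrow> s \<in> {0..1} \<Longrightarrow> c s \<in> U"
    and d: "((\<lambda>s. \<phi> (c s)) has_vector_derivative d) (at t within {0..1})"
  shows "form_along A w c t = w (Frame (U, \<phi>) (c t) [d])"
proof -
  have ct: "c t \<in> U" using N by auto
  obtain V \<psi> where V: "(SOME ch. ch \<in> A \<and> c t \<in> fst ch) = (V, \<psi>)" "(V, \<psi>) \<in> A" "c t \<in> V"
    using some_chart[OF ch ct] .
  let ?T = "\<psi> \<circ> inv_into U \<phi>"
  let ?D = "frechet_derivative ?T (at (\<phi> (c t)))"
  have "((?T \<circ> (\<lambda>s. \<phi> (c s))) has_vector_derivative ?D d) (at t within {0..1})"
    using ct V(3)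
    by (intro vector_derivative_diff_chain_within[OF d has_derivative_at_withinI]
        has_derivative_transition[OF ch V(2)]) simp
  then have "((\<lambda>s. \<psi> (c s)) has_vector_derivative ?D d) (at t within {0..1})"
    by (rule has_vector_derivative_transform_nbhd[OF _ N(1-3)]) (simp add: chart_inv[OF ch] N(4))
  then have "vector_derivative (\<lambda>s. \<psi> (c s)) (at t within {0..1}) = ?D d"
    using N(3) by (intro vector_derivative_within_closed_interval) auto
  then show ?thesis
    using form_chart_change[OF w _ ch V(2) ct V(3), of "[d]"] by (simp add: form_along_def V(1))
qed

text \<open>The velocity is 0. This disposes of the edge of the square that is collapsed to a
  vertex.\<close>

lemma form_along_const:
  fixes w :: "('n::euclidean_space, 'm, 'e) form"
  assumes w: "w \<in> forms (Continuous X A) 1" and ch: "(U, \<phi>) \<in> A" "p \<in> U" and t: "t \<in> {0..1}"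
  shows "form_along A w (\<lambda>_. p) t = 0"
proof -
  have "form_along A w (\<lambda>_. p) t = w (Frame (U, \<phi>) p [0])"
    using t ch by (intro form_along_eq[OF w ch(1), of UNIV]) auto
  then show ?thesis using linear_0[OF one_form_linear[OF w ch]] by simp
qed

lemma continuous_form_along:
  fixes w :: "('n::euclidean_space, 'm, 'e) form"
  assumes w: "w \<in> forms (Continuous X A) 1" and c: "smooth_curve A c"
  shows "continuous_on {0..1} (form_along A w c)"
proof (rule continuous_on_locally)
  fix t :: real assume t: "t \<in> {0..1}"
  obtain U \<phi> N g g' where ch: "(U, \<phi>) \<in> A" and N: "open N" "t \<in> N"
    and g_der: "\<forall>s\<in>N. (g has_vector_derivative g' s) (at s)"
    and g'_cont: "continuous_on N g'" and gU: "g ` N \<subseteq> \<phi> ` U"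
    and gc': "\<forall>s\<in>N \<inter> {0..1}. c s \<in> U \<and> g s = \<phi> (c s)"
    using smooth_curveE[OF c t] .
  have g: "(g has_vector_derivative g' s) (at s)" if "s \<in> N" for s using g_der that by blast
  have cU: "c s \<in> U" and gc: "g s = \<phi> (c s)" if "s \<in> N" "s \<in> {0..1}" for s
    using gc' that by auto
  \<comment> \<open>The integrand in the chart, expanded in the basis because the components of
    \<open>w\<close> are known to be continuous for fixed frames.\<close>
  let ?a = "\<lambda>s. \<Sum>b\<in>Basis. (g' s \<bullet> b) * w (Frame (U, \<phi>) (inv_into U \<phi> (g s)) [b])"
  have "continuous_on N g"
    using g by (auto intro!: continuous_at_imp_continuous_on has_vector_derivative_continuous)
  then have "continuous_on N ?a"
    by (intro continuous_intros g'_cont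
        continuous_on_compose2[OF Ck_imp_continuous_on[OF form_smooth[OF w ch]] _ gU]) auto
  moreover have "form_along A w c s = ?a s" if s: "s \<in> N" "s \<in> {0..1}" for s
  proof -
    have "((\<lambda>s. \<phi> (c s)) has_vector_derivative g' s) (at s within {0..1})"
      by (rule has_vector_derivative_transform_nbhd[OF has_vector_derivative_at_within[OF g[OF s(1)]] N(1) s])
        (use gc in auto)
    then have "form_along A w c s = w (Frame (U, \<phi>) (c s) [g' s])"
      using cU by (intro form_along_eq[OF w ch N(1) s]) auto
    also have "\<dots> = ?a s"
      using linear_basis_expansion[OF one_form_linear[OF w ch cU[OF s]], of "g' s"]
      by (simp add: gc[OF s] chart_inv[OF ch cU[OF s]])
    finally show ?thesis .
  qed
  ultimately show "\<exists>N g. open N \<and> t \<in> N \<and> continuous_on N g \<and> (\<forall>s\<in>N \<inter> {0..1}. form_along A w c s = g s)"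
    using N by (intro exI[of _ N] exI[of _ ?a]) auto
qed

text \<open>The function \<open>f\<close> along the curve is an antiderivative. The exact part df
  enters as the difference of \<open>v\<close> and \<open>w\<close>: both are known to be 1-forms,
  so \<open>form_along_eq\<close> applies to each, and the transformation law of df need not be
  verified.\<close>

lemma form_along_diff_has_integral:
  fixes f :: "('n::euclidean_space, 'm, 'e) form"
  assumes f: "f \<in> forms (Continuous X A) 0"
    and v: "v \<in> forms (Continuous X A) 1" and w: "w \<in> forms (Continuous X A) 1"
    and eq: "v = coboundary (Continuous X A) 0 f + w" and c: "smooth_curve A c"
  shows "((\<lambda>t. form_along A v c t - form_along A w c t) has_integral
    eval_at A f (c 1) - eval_at A f (c 0)) {0..1}"
proof (rule fundamental_theorem_of_calculus)
  fix t :: real assume t: "t \<in> {0..1}"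
  obtain U \<phi> N g g' where ch: "(U, \<phi>) \<in> A" and N: "open N" "t \<in> N"
    and g_der: "\<forall>s\<in>N. (g has_vector_derivative g' s) (at s)"
    and g'_cont: "continuous_on N g'" and gU: "g ` N \<subseteq> \<phi> ` U"
    and gc': "\<forall>s\<in>N \<inter> {0..1}. c s \<in> U \<and> g s = \<phi> (c s)"
    using smooth_curveE[OF c t] .
  have g: "(g has_vector_derivative g' s) (at s)" if "s \<in> N" for s using g_der that by blast
  have cU: "c s \<in> U" and gc: "g s = \<phi> (c s)" if "s \<in> N" "s \<in> {0..1}" for s
    using gc' that by auto
  let ?f = "\<lambda>x. f (Frame (U, \<phi>) (inv_into U \<phi> x) [])"
  let ?D = "frechet_derivative ?f (at (g t))"
  have "(?f has_derivative ?D) (at (g t))"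
    by (rule Ck_SucD(1)[OF form_smooth[OF f ch]]) (use gU N(2) in auto)
  then have "((?f \<circ> g) has_vector_derivative ?D (g' t)) (at t within {0..1})"
    by (rule vector_derivative_diff_chain_within[OF has_vector_derivative_at_within[OF g[OF N(2)]] has_derivative_at_withinI])
  then have "((\<lambda>s. eval_at A f (c s)) has_vector_derivative ?D (g' t)) (at t within {0..1})"
    by (rule has_vector_derivative_transform_nbhd[OF _ N t])
      (simp add: gc cU chart_inv[OF ch] eval_at_eq[OF f ch])
  moreover have "((\<lambda>s. \<phi> (c s)) has_vector_derivative g' t) (at t within {0..1})"
    by (rule has_vector_derivative_transform_nbhd[OF has_vector_derivative_at_within[OF g[OF N(2)]] N t])
      (use gc in auto)
  then have "form_along A v c t = v (Frame (U, \<phi>) (c t) [g' t])"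
    and "form_along A w c t = w (Frame (U, \<phi>) (c t) [g' t])"
    using cU by (auto intro!: form_along_eq[OF v ch N t] form_along_eq[OF w ch N t])
  then have "form_along A v c t - form_along A w c t =
      coboundary (Continuous X A) 0 f (Frame (U, \<phi>) (c t) [g' t])"
    by (simp add: eq)
  moreover have "\<dots> = ?D (g' t)"
    using ch cU[OF N(2) t] by (simp add: gc[OF N(2) t])
  ultimately show "((\<lambda>s. eval_at A f (c s)) has_vector_derivative
      form_along A v c t - form_along A w c t) (at t within {0..1})"
    by simp
qed simp

lemma stokes_square:
  fixes w :: "('n::euclidean_space, 'm, 'e) form"
  assumes w: "w \<in> forms (Continuous X A) 1" and closed: "coboundary (Continuous X A) 1 w = 0"
    and F: "smooth_square A F"
  shows "integral {0..1} (form_along A w (\<lambda>s. F (s, 1))) - integral {0..1} (form_along A w (\<lambda>s. F (s, 0))) =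
    integral {0..1} (form_along A w (\<lambda>u. F (1, u))) - integral {0..1} (form_along A w (\<lambda>u. F (0, u)))"
proof -
  let ?Q = "{0..1::real} \<times> {0..1::real}"
  \<comment> \<open>These definitions make sense on the whole square, although no single chart need
    contain its image.\<close>
  define \<alpha> where "\<alpha> z = form_along A w (\<lambda>s. F (s, snd z)) (fst z)" for z
  define \<beta> where "\<beta> z = form_along A w (\<lambda>u. F (fst z, u)) (snd z)" for z
  define \<delta> where "\<delta> z = vector_derivative (\<lambda>u. \<alpha> (fst z, u)) (at (snd z) within {0..1})" for z
  \<comment> \<open>All requirements of \<open>green_unit_square\<close> are local. Near a point one
    chart suffices, and there the components agree on the square with those of a form pulled back
    along a C^2 extension \<open>g\<close> defined on an open set.\<close>
  have local: "\<exists>N. open N \<and> z \<in> N \<and>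
      (\<exists>f. continuous_on N f \<and> (\<forall>y\<in>N \<inter> ?Q. \<alpha> y = f y)) \<and>
      (\<exists>f. continuous_on N f \<and> (\<forall>y\<in>N \<inter> ?Q. \<beta> y = f y)) \<and>
      (\<exists>f. continuous_on N f \<and> (\<forall>y\<in>N \<inter> ?Q. \<delta> y = f y)) \<and>
      (\<forall>y\<in>N \<inter> ?Q. ((\<lambda>u. \<alpha> (fst y, u)) has_vector_derivative \<delta> y) (at (snd y) within {0..1})) \<and>
      (\<forall>y\<in>N \<inter> ?Q. ((\<lambda>s. \<beta> (s, snd y)) has_vector_derivative \<delta> y) (at (fst y) within {0..1}))"
    if z: "z \<in> ?Q" for z
  proof -
    obtain U \<phi> N g where ch: "(U, \<phi>) \<in> A" and N: "open N" "z \<in> N" "Ck 2 N g" "g ` N \<subseteq> \<phi> ` U"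
      and gF': "\<forall>y\<in>N \<inter> ?Q. F y \<in> U \<and> g y = \<phi> (F y)"
      using smooth_squareE[OF F z] .
    have FU: "F y \<in> U" and gF: "g y = \<phi> (F y)" if "y \<in> N" "y \<in> ?Q" for y
      using gF' that by auto
    define a where "a x v = w (Frame (U, \<phi>) (inv_into U \<phi> x) [v])" for x v
    define \<alpha>' where "\<alpha>' z = a (g z) (frechet_derivative g (at z) (1, 0))" for z
    define \<beta>' where "\<beta>' z = a (g z) (frechet_derivative g (at z) (0, 1))" for z
    define \<delta>' where "\<delta>' z = frechet_derivative \<alpha>' (at z) (0, 1)" for z
    have C2: "Ck (Suc 1) N g" using N(3) by (simp only: Suc_1)
    have a: "Ck 1 (\<phi> ` U) (\<lambda>x. a x v)" for v
      unfolding a_def by (rule form_smooth[OF w ch]) simp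
    have a_lin: "linear (a x)" if "x \<in> \<phi> ` U" for x
      using one_form_linear[OF w ch] that by (auto simp: a_def[abs_def] chart_inv[OF ch])
    have a_closed: "frechet_derivative (\<lambda>x. a x v) (at x) u = frechet_derivative (\<lambda>x. a x u) (at x) v"
      if x: "x \<in> \<phi> ` U" for x u v
    proof -
      obtain p where p: "x = \<phi> p" "p \<in> U" using x by blast
      \<comment> \<open>The two summands of the coboundary on the frame \<open>[u, v]\<close> are,
        up to sign, the two sides of the claim.\<close>
      have "coboundary (Continuous X A) 1 w (Frame (U, \<phi>) p [u, v]) = 0"
        unfolding closed by simp
      with ch p show ?thesis by (simp add: a_def[abs_def])
    qed
    have pullback_Ck: "Ck 1 N (\<lambda>z. a (g z) (frechet_derivative g (at z) v))" for v
      by (rule closed_form_pullback(1)[OF N(1,3,4) a a_lin a_closed])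
    have \<alpha>'1: "Ck (Suc 0) N \<alpha>'" and \<beta>'1: "Ck (Suc 0) N \<beta>'"
      using pullback_Ck by (simp_all add: \<alpha>'_def[abs_def] \<beta>'_def[abs_def] del: Ck.simps)
    have \<delta>'_eq: "\<delta>' y = frechet_derivative \<beta>' (at y) (1, 0)" if "y \<in> N" for y
      \<comment> \<open>This is where closedness enters: \<open>\<delta>'\<close> is introduced as a
        derivative of \<open>\<alpha>'\<close> and turns out to be one of
        \<open>\<beta>'\<close>.\<close>
      unfolding \<delta>'_def \<alpha>'_def[abs_def] \<beta>'_def[abs_def]
      by (rule closed_form_pullback(2)[OF N(1,3,4) a a_lin a_closed that])
    have open_fst: "open ((\<lambda>s. (s, u)) -` N)" for u
      by (intro open_vimage N(1) continuous_intros)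
    have open_snd: "open (Pair s -` N)" for s
      by (intro open_vimage N(1) continuous_intros)
    have \<alpha>_eq: "\<alpha> y = \<alpha>' y" if y: "y \<in> N" "y \<in> ?Q" for y
    proof -
      obtain s u where su: "y = (s, u)" by (cases y)
      have "((\<lambda>s. \<phi> (F (s, u))) has_vector_derivative frechet_derivative g (at (s, u)) (1, 0)) (at s within {0..1})"
        by (rule has_vector_derivative_transform_nbhd[OF
              has_vector_derivative_fst[OF Ck_SucD(1)[OF C2, of "(s, u)"]] open_fst[of u]])
          (use y su gF in auto)
      then have "form_along A w (\<lambda>s. F (s, u)) s = w (Frame (U, \<phi>) (F (s, u)) [frechet_derivative g (at (s, u)) (1, 0)])"
        by (rule form_along_eq[OF w ch open_fst[of u], rotated -1]) (use y su FU in auto)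
      then show ?thesis
        using gF[OF y] chart_inv[OF ch FU[OF y]] by (simp add: \<alpha>_def \<alpha>'_def a_def su)
    qed
    have \<beta>_eq: "\<beta> y = \<beta>' y" if y: "y \<in> N" "y \<in> ?Q" for y
    proof -
      obtain s u where su: "y = (s, u)" by (cases y)
      have "((\<lambda>u. \<phi> (F (s, u))) has_vector_derivative frechet_derivative g (at (s, u)) (0, 1)) (at u within {0..1})"
        by (rule has_vector_derivative_transform_nbhd[OF
              has_vector_derivative_snd[OF Ck_SucD(1)[OF C2, of "(s, u)"]] open_snd[of s]])
          (use y su gF in auto)
      then have "form_along A w (\<lambda>u. F (s, u)) u = w (Frame (U, \<phi>) (F (s, u)) [frechet_derivative g (at (s, u)) (0, 1)])"
        by (rule form_along_eq[OF w ch open_snd[of s], rotated -1]) (use y su FU in auto)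
      then show ?thesis
        using gF[OF y] chart_inv[OF ch FU[OF y]] by (simp add: \<beta>_def \<beta>'_def a_def su)
    qed
    have \<alpha>_der: "((\<lambda>u. \<alpha> (fst y, u)) has_vector_derivative \<delta>' y) (at (snd y) within {0..1})"
      if y: "y \<in> N" "y \<in> ?Q" for y
    proof -
      obtain s u where su: "y = (s, u)" by (cases y)
      show ?thesis unfolding \<delta>'_def su fst_conv snd_conv
        by (rule has_vector_derivative_transform_nbhd[OF
              has_vector_derivative_snd[OF Ck_SucD(1)[OF \<alpha>'1]] open_snd[of s]])
          (use y su in \<open>auto simp: \<alpha>_eq\<close>)
    qed
    have \<beta>_der: "((\<lambda>s. \<beta> (s, snd y)) has_vector_derivative \<delta>' y) (at (fst y) within {0..1})"
      if y: "y \<in> N" "y \<in> ?Q" for y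
    proof -
      obtain s u where su: "y = (s, u)" by (cases y)
      show ?thesis unfolding \<delta>'_eq[OF y(1)] unfolding su fst_conv snd_conv
        by (rule has_vector_derivative_transform_nbhd[OF
              has_vector_derivative_fst[OF Ck_SucD(1)[OF \<beta>'1]] open_fst[of u]])
          (use y su in \<open>auto simp: \<beta>_eq\<close>)
    qed
    have \<delta>_eq: "\<delta> y = \<delta>' y" if y: "y \<in> N" "y \<in> ?Q" for y
      unfolding \<delta>_def using y
      by (intro vector_derivative_within_closed_interval[OF _ _ \<alpha>_der]) auto
    have "continuous_on N \<delta>'"
      unfolding \<delta>'_def[abs_def] by (rule Ck_imp_continuous_on[OF Ck_SucD(2)[OF \<alpha>'1]])
    then show ?thesis
      using N(1,2) \<alpha>_eq \<beta>_eq \<delta>_eq \<alpha>_der \<beta>_der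
        Ck_imp_continuous_on[OF \<alpha>'1] Ck_imp_continuous_on[OF \<beta>'1]
      by (intro exI[of _ N] conjI exI[of _ \<alpha>'] exI[of _ \<beta>'] exI[of _ \<delta>']) auto
  qed
  have "integral {0..1} (\<lambda>s. \<alpha> (s, 1)) - integral {0..1} (\<lambda>s. \<alpha> (s, 0)) =
    integral {0..1} (\<lambda>u. \<beta> (1, u)) - integral {0..1} (\<lambda>u. \<beta> (0, u))"
  proof (rule green_unit_square)
    fix s u :: real assume su: "s \<in> {0..1}" "u \<in> {0..1}"
    then have "(s, u) \<in> ?Q" by simp
    from local[OF this] obtain N where N: "(s, u) \<in> N"
      "\<forall>y\<in>N \<inter> ?Q. ((\<lambda>u. \<alpha> (fst y, u)) has_vector_derivative \<delta> y) (at (snd y) within {0..1})"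
      "\<forall>y\<in>N \<inter> ?Q. ((\<lambda>s. \<beta> (s, snd y)) has_vector_derivative \<delta> y) (at (fst y) within {0..1})"
      by (elim exE conjE)
    show "((\<lambda>u. \<alpha> (s, u)) has_vector_derivative \<delta> (s, u)) (at u within {0..1})"
      using bspec[OF N(2), of "(s, u)"] N(1) su by simp
    show "((\<lambda>s. \<beta> (s, u)) has_vector_derivative \<delta> (s, u)) (at s within {0..1})"
      using bspec[OF N(3), of "(s, u)"] N(1) su by simp
  next
    show "continuous_on ?Q \<alpha>"
    proof (rule continuous_on_locally)
      fix z assume "z \<in> ?Q"
      from local[OF this] obtain N where "open N" "z \<in> N"
        "\<exists>f. continuous_on N f \<and> (\<forall>y\<in>N \<inter> ?Q. \<alpha> y = f y)"
        by (elim exE, elim conjE)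
      then show "\<exists>N f. open N \<and> z \<in> N \<and> continuous_on N f \<and> (\<forall>y\<in>N \<inter> ?Q. \<alpha> y = f y)"
        by blast
    qed
    show "continuous_on ?Q \<beta>"
    proof (rule continuous_on_locally)
      fix z assume "z \<in> ?Q"
      from local[OF this] obtain N where "open N" "z \<in> N"
        "\<exists>f. continuous_on N f \<and> (\<forall>y\<in>N \<inter> ?Q. \<beta> y = f y)"
        by (elim exE, elim conjE)
      then show "\<exists>N f. open N \<and> z \<in> N \<and> continuous_on N f \<and> (\<forall>y\<in>N \<inter> ?Q. \<beta> y = f y)"
        by blast
    qed
    show "continuous_on ?Q \<delta>"
    proof (rule continuous_on_locally)
      fix z assume "z \<in> ?Q"
      from local[OF this] obtain N where "open N" "z \<in> N"
        "\<exists>f. continuous_on N f \<and> (\<forall>y\<in>N \<inter> ?Q. \<delta> y = f y)"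
        by (elim exE, elim conjE)
      then show "\<exists>N f. open N \<and> z \<in> N \<and> continuous_on N f \<and> (\<forall>y\<in>N \<inter> ?Q. \<delta> y = f y)"
        by blast
    qed
  qed
  then show ?thesis by (simp add: \<alpha>_def \<beta>_def)
qed

end

section \<open>Smooth singular simplices in coordinates\<close>

text \<open>\<open>dir_deriv\<close> differentiates at time 0 along a line based at the point
  itself; a shift of the parameter moves this to an arbitrary time on an affine line
  \<open>P\<close> with direction \<open>v\<close>.\<close>

lemma coord_Ck_directional:
  assumes h: "coord_Ck (Suc k) W h" and P: "P t \<in> W" "\<And>s i. P s i = P t i + (s - t) * v i"
  shows "((\<lambda>s. h (P s)) has_vector_derivative dir_deriv v h (P t)) (at t)"
proof -
  let ?f = "\<lambda>s. h (\<lambda>i. P t i + s * v i)"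
  have "?f differentiable (at 0)"
    using h P(1) by simp
  then have "(?f has_vector_derivative dir_deriv v h (P t)) (at (t - t))"
    by (simp add: dir_deriv_def vector_derivative_works)
  moreover have "((\<lambda>s. s - t) has_vector_derivative 1) (at t)"
    by (auto intro!: derivative_eq_intros)
  ultimately have "(?f \<circ> (\<lambda>s. s - t) has_vector_derivative 1 *\<^sub>R dir_deriv v h (P t)) (at t)"
    by (intro vector_diff_chain_at)
  moreover have "?f \<circ> (\<lambda>s. s - t) = (\<lambda>s. h (P s))"
    by (simp add: o_def P(2)[symmetric])
  ultimately show ?thesis by simp
qed

lemma coord_Ck_SucD:
  assumes "coord_Ck (Suc k) W h"
  shows "coord_Ck k W (dir_deriv v h)"
  using assms by simp

lemma coord_Ck_imp_continuous_on: "coord_Ck k W h \<Longrightarrow> continuous_on W h"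
  by (cases k) auto

text \<open>Smoothness of a simplex supplies directional derivatives only; continuity of a partial
  derivative upgrades them to a Frechet derivative, as \<open>Ck\<close> demands.\<close>

lemma has_derivative_of_partials:
  fixes f :: "real \<times> real \<Rightarrow> 'b::real_normed_vector"
  assumes "open N" "z \<in> N"
    and fs: "\<And>s u. (s, u) \<in> N \<Longrightarrow> ((\<lambda>s. f (s, u)) has_vector_derivative fs (s, u)) (at s)"
    and fu: "\<And>s u. (s, u) \<in> N \<Longrightarrow> ((\<lambda>u. f (s, u)) has_vector_derivative fu (s, u)) (at u)"
    and cont: "continuous_on N fu"
  shows "(f has_derivative (\<lambda>v. fst v *\<^sub>R fs z + snd v *\<^sub>R fu z)) (at z)"
proof -
  obtain s u where z: "z = (s, u)" by (cases z)
  obtain S T where ST: "open S" "open T" "s \<in> S" "u \<in> T" "S \<times> T \<subseteq> N"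
    using open_prod_elim[OF assms(1,2)] z by (metis mem_Sigma_iff)
  obtain e where e: "e > 0" "ball u e \<subseteq> T" using ST open_contains_ball by blast
  let ?B = "ball u e"
  have sub: "S \<times> ?B \<subseteq> N" using ST e by blast
  have "((\<lambda>(x, y). f (x, y)) has_derivative
      (\<lambda>(tx, ty). tx *\<^sub>R fs (s, u) + blinfun_apply (blinfun_scaleR_left (fu (s, u))) ty)) (at (s, u) within S \<times> ?B)"
  proof (rule has_derivative_partialsI)
    show "((\<lambda>x. f (x, u)) has_derivative (\<lambda>t. t *\<^sub>R fs (s, u))) (at s within S)"
      using has_vector_derivative_at_within[OF fs] assms(2) z
      by (simp add: has_vector_derivative_def)
    show "((\<lambda>y. f (x, y)) has_derivative blinfun_apply (blinfun_scaleR_left (fu (x, y)))) (at y within ?B)"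
      if "x \<in> S" "y \<in> ?B" for x y
    proof -
      have "(x, y) \<in> N" using that sub by blast
      from has_vector_derivative_at_within[OF fu[OF this]] show ?thesis
        by (simp add: has_vector_derivative_def)
    qed
    have "continuous_on (S \<times> ?B) (\<lambda>z. blinfun_scaleR_left (fu z))"
      by (intro continuous_intros continuous_on_subset[OF cont sub])
    then show "continuous (at (s, u) within S \<times> ?B) (\<lambda>(x, y). blinfun_scaleR_left (fu (x, y)))"
      using ST(3) e(1) by (simp add: continuous_on_eq_continuous_within split_def)
  qed (use e in auto)
  moreover have "at (s, u) within S \<times> ?B = at (s, u)"
    using ST e by (intro at_within_open open_Times) auto
  ultimately show ?thesis by (simp add: z split_def)
qed

text \<open>Barycentric coordinates with vertices 0, 1, 2 at (0, 0), (1, 0), (0, 1). The map is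
  defined on the whole plane, so extensions beyond the closed simplex can be pulled back as
  well.\<close>

definition triangle_point :: "real \<times> real \<Rightarrow> nat \<Rightarrow> real" where
  "triangle_point z = (\<lambda>i. if i = 0 then 1 - fst z - snd z else if i = 1 then fst z
     else if i = 2 then snd z else 0)"

lemma continuous_on_triangle_point: "continuous_on S triangle_point"
proof (rule continuous_on_coordinatewise_then_product)
  show "continuous_on S (\<lambda>z. triangle_point z i)" for i
    unfolding triangle_point_def
    by (cases "i = 0"; cases "i = 1"; cases "i = 2") (auto intro!: continuous_intros)
qed

lemma continuous_on_segment_point: "continuous_on S segment_point"
proof (rule continuous_on_coordinatewise_then_product)
  show "continuous_on S (\<lambda>z. segment_point z i)" for i
    unfolding segment_point_def
    by (cases "i = 0"; cases "i = 1"; cases "i = 2") (auto intro!: continuous_intros)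
qed

text \<open>The partial derivatives of \<open>h \<circ> triangle_point\<close> are compositions of
  the same shape, with \<open>h\<close> replaced by a directional derivative, so the induction
  closes for arbitrary \<open>h\<close>.\<close>

lemma Ck_triangle_point:
  assumes "open W" "coord_Ck k W h"
  shows "Ck k (triangle_point -` W) (h \<circ> triangle_point)"
  using assms(2)
proof (induction k arbitrary: h)
  case 0
  then show ?case
    by (auto simp: o_def intro!: continuous_on_compose2[OF _ continuous_on_triangle_point])
next
  case (Suc k)
  let ?N = "triangle_point -` W"
  \<comment> \<open>The differences of vertices 1 and 0 and of vertices 2 and 0: the constant
    velocities of \<open>triangle_point\<close> in its two variables.\<close>
  let ?v = "\<lambda>i::nat. if i = 0 then -1 else if i = 1 then 1 else (0::real)"
  let ?w = "\<lambda>i::nat. if i = 0 then -1 else if i = 2 then 1 else (0::real)"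
  have N: "open ?N"
    using assms(1) continuous_on_triangle_point by (intro open_vimage) auto
  have IH: "Ck k ?N (dir_deriv v h \<circ> triangle_point)" for v
    by (rule Suc.IH[OF coord_Ck_SucD[OF Suc.prems]])
  have der: "((h \<circ> triangle_point) has_derivative (\<lambda>x. fst x *\<^sub>R (dir_deriv ?v h \<circ> triangle_point) z +
      snd x *\<^sub>R (dir_deriv ?w h \<circ> triangle_point) z)) (at z)" if "z \<in> ?N" for z
  proof (rule has_derivative_of_partials[OF N that])
    fix s u assume su: "(s, u) \<in> ?N"
    show "((\<lambda>s. (h \<circ> triangle_point) (s, u)) has_vector_derivative
        (dir_deriv ?v h \<circ> triangle_point) (s, u)) (at s)"
      unfolding o_def using su
      by (intro coord_Ck_directional[OF Suc.prems]) (auto simp: triangle_point_def)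
    show "((\<lambda>u. (h \<circ> triangle_point) (s, u)) has_vector_derivative
        (dir_deriv ?w h \<circ> triangle_point) (s, u)) (at u)"
      unfolding o_def using su
      by (intro coord_Ck_directional[OF Suc.prems]) (auto simp: triangle_point_def)
  next
    show "continuous_on ?N (dir_deriv ?w h \<circ> triangle_point)"
      by (rule Ck_imp_continuous_on[OF IH])
  qed
  show ?case
    by (rule Ck_SucI[OF N der], assumption)
      (intro Ck_add N bounded_bilinear.Ck_prod[OF bounded_bilinear_scaleR] Ck_const IH)
qed

text \<open>The edge s = 0 collapses to vertex 0. The edges s = 1, u = 1 and u = 0 traverse the
  faces opposite vertices 0, 1 and 2 with exactly the parametrisation of
  \<open>singular_face\<close>, so no reparametrisation of integrals is necessary.\<close>

definition square_to_triangle :: "real \<times> real \<Rightarrow> real \<times> real" where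
  "square_to_triangle z = (fst z * (1 - snd z), fst z * snd z)"

lemma Ck_square_to_triangle:
  assumes "open S"
  shows "Ck k S square_to_triangle"
proof -
  have "Ck k S (\<lambda>z. (fst z * (1 + - snd z)) *\<^sub>R (1, 0) + (fst z * snd z) *\<^sub>R (0, 1) :: real \<times> real)"
    by (intro Ck_add assms bounded_bilinear.Ck_prod[OF bounded_bilinear_scaleR]
        bounded_bilinear.Ck_prod[OF bounded_bilinear_mult] Ck_const
        Ck_bounded_linear bounded_linear_fst bounded_linear_snd bounded_linear_minus)
  then show ?thesis
    by (rule Ck_cong[OF assms, rotated]) (simp add: square_to_triangle_def)
qed

lemma triangle_point_in_standard_simplex:
  assumes "z \<in> {0..1} \<times> {0..1}"
  shows "triangle_point (square_to_triangle z) \<in> standard_simplex 2"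
proof -
  obtain s u where z: "z = (s, u)" and su: "0 \<le> s" "s \<le> 1" "0 \<le> u" "u \<le> 1"
    using assms by auto
  have "0 \<le> s * u" "s * u \<le> s" using su by (simp_all add: mult_left_le)
  moreover have "s \<le> 1 + s * u" using su(2) calculation(1) by linarith
  ultimately show ?thesis
    using su by (auto simp: z standard_simplex_def triangle_point_def square_to_triangle_def
        algebra_simps numeral_2_eq_2)
qed

lemma segment_point_in_standard_simplex:
  assumes "t \<in> {0..1}"
  shows "segment_point t \<in> standard_simplex 1"
  using assms by (auto simp: standard_simplex_def segment_point_def)

lemma smooth_singular_simplexE:
  assumes "smooth_singular_simplex n X A \<sigma>" "x \<in> standard_simplex n"
  obtains U \<phi> W h where "(U, \<phi>) \<in> A" "open W" "x \<in> W" "coord_smooth_on W h"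
    "\<forall>y\<in>W \<inter> standard_simplex n. \<sigma> y \<in> U \<and> h y = \<phi> (\<sigma> y)"
  using assms unfolding smooth_singular_simplex_def by blast

section \<open>Gradient theorem and Stokes' theorem for smooth singular simplices\<close>

context
  fixes X :: "'m topology" and A :: "('m, 'e::euclidean_space) chart set"
  assumes X: "smooth_manifold X A"
begin

lemma smooth_curve_simplex:
  assumes \<sigma>: "smooth_singular_simplex 1 X A \<sigma>"
  shows "smooth_curve A (\<sigma> \<circ> segment_point)"
  unfolding smooth_curve_def
proof
  fix t :: real assume t: "t \<in> {0..1}"
  obtain U \<phi> W h where ch: "(U, \<phi>) \<in> A" and W: "open W" "segment_point t \<in> W" "coord_smooth_on W h"
    and h: "\<forall>y\<in>W \<inter> standard_simplex 1. \<sigma> y \<in> U \<and> h y = \<phi> (\<sigma> y)"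
    using smooth_singular_simplexE[OF \<sigma> segment_point_in_standard_simplex[OF t]] .
  let ?v = "\<lambda>i::nat. if i = 0 then -1 else if i = 1 then 1 else (0::real)"
  have C1: "coord_Ck (Suc 0) W h" using W(3) unfolding coord_smooth_on_def by blast
  have cont: "continuous_on (segment_point -` W) (h \<circ> segment_point)"
    using coord_Ck_imp_continuous_on[OF C1]
    by (auto simp: o_def intro!: continuous_on_compose2[OF _ continuous_on_segment_point])
  have oW: "open (segment_point -` W)"
    using W(1) continuous_on_segment_point by (intro open_vimage) auto
  \<comment> \<open>Outside the simplex the extension \<open>h\<close> may leave the image of the
    chart, where forms have no components; the neighbourhood is shrunk to prevent this.\<close>
  define N where "N = (h \<circ> segment_point) -` (\<phi> ` U) \<inter> segment_point -` W"
  have "open N"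
    unfolding N_def using continuous_open_preimage[OF cont oW chart_homeomorphic(2)[OF X ch]]
    by (simp add: Int_commute)
  have "t \<in> N"
    using t W(2) h segment_point_in_standard_simplex[OF t] by (auto simp: N_def)
  have "\<forall>s\<in>N. ((h \<circ> segment_point) has_vector_derivative (dir_deriv ?v h \<circ> segment_point) s) (at s)"
    unfolding o_def
    by (intro ballI coord_Ck_directional[OF C1]) (auto simp: segment_point_def N_def)
  have "continuous_on N (dir_deriv ?v h \<circ> segment_point)"
    using coord_Ck_imp_continuous_on[OF coord_Ck_SucD[OF C1, of ?v]]
    by (auto simp: o_def N_def intro!: continuous_on_compose2[OF _ continuous_on_segment_point])
  have "\<forall>s\<in>N \<inter> {0..1}. (\<sigma> \<circ> segment_point) s \<in> U \<and> (h \<circ> segment_point) s = \<phi> ((\<sigma> \<circ> segment_point) s)"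
    using h segment_point_in_standard_simplex by (auto simp: N_def)
  have "(h \<circ> segment_point) ` N \<subseteq> \<phi> ` U" by (auto simp: N_def)
  have "\<exists>N g g'. open N \<and> t \<in> N \<and>
     (\<forall>s\<in>N. (g has_vector_derivative g' s) (at s)) \<and> continuous_on N g' \<and> g ` N \<subseteq> \<phi> ` U \<and>
     (\<forall>s\<in>N \<inter> {0..1}. (\<sigma> \<circ> segment_point) s \<in> U \<and> g s = \<phi> ((\<sigma> \<circ> segment_point) s))"
    by (rule exI[of _ N], rule exI[of _ "h \<circ> segment_point"],
        rule exI[of _ "dir_deriv ?v h \<circ> segment_point"], intro conjI) fact+
  with ch show "\<exists>(U, \<phi>)\<in>A. \<exists>N g g'. open N \<and> t \<in> N \<and>
     (\<forall>s\<in>N. (g has_vector_derivative g' s) (at s)) \<and> continuous_on N g' \<and> g ` N \<subseteq> \<phi> ` U \<and>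
     (\<forall>s\<in>N \<inter> {0..1}. (\<sigma> \<circ> segment_point) s \<in> U \<and> g s = \<phi> ((\<sigma> \<circ> segment_point) s))"
    by (intro bexI[of _ "(U, \<phi>)"]) (simp_all only: split)
qed

lemma smooth_square_simplex:
  assumes \<sigma>: "smooth_singular_simplex 2 X A \<sigma>"
  shows "smooth_square A (\<sigma> \<circ> triangle_point \<circ> square_to_triangle)"
  unfolding smooth_square_def
proof
  fix z :: "real \<times> real" assume z: "z \<in> {0..1} \<times> {0..1}"
  let ?T = "\<lambda>z. triangle_point (square_to_triangle z)"
  obtain U \<phi> W h where ch: "(U, \<phi>) \<in> A" and W: "open W" "?T z \<in> W" "coord_smooth_on W h"
    and h: "\<forall>y\<in>W \<inter> standard_simplex 2. \<sigma> y \<in> U \<and> h y = \<phi> (\<sigma> y)"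
    using smooth_singular_simplexE[OF \<sigma> triangle_point_in_standard_simplex[OF z]] .
  let ?g = "\<lambda>z. (h \<circ> triangle_point) (square_to_triangle z)"
  let ?M = "square_to_triangle -` (triangle_point -` W)"
  have "open (triangle_point -` W)"
    using W(1) continuous_on_triangle_point by (intro open_vimage) auto
  then have M: "open ?M"
    using Ck_imp_continuous_on[OF Ck_square_to_triangle[OF open_UNIV, of 0]] by (rule open_vimage)
  have "coord_Ck 2 W h" using W(3) unfolding coord_smooth_on_def by blast
  then have C2: "Ck 2 ?M ?g"
    by (intro Ck_compose[OF M Ck_triangle_point[OF W(1)] Ck_square_to_triangle[OF M]]) auto
  define N where "N = ?g -` (\<phi> ` U) \<inter> ?M"
  have "open N"
    unfolding N_def using continuous_open_preimage[OF Ck_imp_continuous_on[OF C2] M chart_homeomorphic(2)[OF X ch]]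
    by (simp add: Int_commute)
  moreover have "z \<in> N"
    using W(2) h triangle_point_in_standard_simplex[OF z] by (auto simp: N_def)
  moreover have "Ck 2 N ?g"
    by (rule Ck_subset[OF C2]) (auto simp: N_def)
  moreover have "?g ` N \<subseteq> \<phi> ` U" by (auto simp: N_def)
  moreover have "\<forall>y\<in>N \<inter> {0..1} \<times> {0..1}. (\<sigma> \<circ> triangle_point \<circ> square_to_triangle) y \<in> U \<and>
      ?g y = \<phi> ((\<sigma> \<circ> triangle_point \<circ> square_to_triangle) y)"
    using h triangle_point_in_standard_simplex by (auto simp: N_def)
  ultimately show "\<exists>(U, \<phi>)\<in>A. \<exists>N g. open N \<and> z \<in> N \<and>
     Ck 2 N g \<and> g ` N \<subseteq> \<phi> ` U \<and>
     (\<forall>y\<in>N \<inter> {0..1} \<times> {0..1}. (\<sigma> \<circ> triangle_point \<circ> square_to_triangle) y \<in> U \<and>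
       g y = \<phi> ((\<sigma> \<circ> triangle_point \<circ> square_to_triangle) y))"
    using ch by blast
qed

text \<open>The endpoint values are written as an alternating sum over faces to match
  \<open>sum_boundary_Continuous\<close>; the vector that is 1 at index 0 and 0 elsewhere is the
  only point of the standard 0-simplex.\<close>

lemma line_integral_cohomologous:
  fixes f :: "('n::euclidean_space, 'm, 'e) form"
  assumes f: "f \<in> forms (Continuous X A) 0"
    and v: "v \<in> forms (Continuous X A) 1" and w: "w \<in> forms (Continuous X A) 1"
    and eq: "v = coboundary (Continuous X A) 0 f + w" and \<sigma>: "smooth_singular_simplex 1 X A \<sigma>"
  shows "line_integral A v \<sigma> = line_integral A w \<sigma> +
    (\<Sum>k\<le>1. (-1) ^ k * eval_at A f (singular_face 1 k \<sigma> (\<lambda>i. if i = 0 then 1 else 0)))"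
proof -
  let ?c = "\<sigma> \<circ> segment_point"
  note c = smooth_curve_simplex[OF \<sigma>]
  have int: "form_along A u ?c integrable_on {0..1}" if "u \<in> forms (Continuous X A) 1" for u :: "('n, 'm, 'e) form"
    by (rule integrable_continuous_real[OF continuous_form_along[OF X that c]])
  have "line_integral A v \<sigma> - line_integral A w \<sigma> =
      eval_at A f (\<sigma> (segment_point 1)) - eval_at A f (\<sigma> (segment_point 0))"
    using integral_unique[OF form_along_diff_has_integral[OF X f v w eq c]]
    by (simp add: line_integral_eq_form_along integral_diff[OF int[OF v] int[OF w]])
  \<comment> \<open>The face opposite vertex 0 is the endpoint at time 1, the face opposite vertex 1
    the one at time 0.\<close>
  moreover have "singular_face 1 k \<sigma> (\<lambda>i. if i = 0 then 1 else 0) =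
      \<sigma> (segment_point (if k = 0 then 1 else 0))" if "k \<le> 1" for k
  proof -
    have "simplical_face k (\<lambda>i. if i = 0 then 1 else (0::real)) = segment_point (if k = 0 then 1 else 0)"
      using that by (auto simp: simplical_face_def segment_point_def fun_eq_iff)
    moreover have "(\<lambda>i. if i = 0 then 1 else 0) \<in> standard_simplex 0"
      by (simp add: standard_simplex_0)
    ultimately show ?thesis by (simp add: singular_face_def)
  qed
  ultimately show ?thesis by simp
qed

lemma stokes_simplex:
  fixes w :: "('n::euclidean_space, 'm, 'e) form"
  assumes w: "w \<in> forms (Continuous X A) 1" and closed: "coboundary (Continuous X A) 1 w = 0"
    and \<sigma>: "smooth_singular_simplex 2 X A \<sigma>"
  shows "(\<Sum>k\<le>2. (-1) ^ k * line_integral A w (singular_face 2 k \<sigma>)) = 0"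
proof -
  let ?F = "\<sigma> \<circ> triangle_point \<circ> square_to_triangle"
  have face: "singular_face 2 k \<sigma> (segment_point t) = \<sigma> (simplical_face k (segment_point t))"
    if "t \<in> {0..1}" for k t
    using segment_point_in_standard_simplex[OF that] by (simp add: singular_face_def)
  have *: "line_integral A w (singular_face 2 k \<sigma>) = integral {0..1} (form_along A w c)"
    if "\<And>t. t \<in> {0..1} \<Longrightarrow> simplical_face k (segment_point t) = T t" "c = (\<lambda>t. \<sigma> (T t))" for k c T
    unfolding line_integral_eq_form_along
    by (intro Henstock_Kurzweil_Integration.integral_cong form_along_cong) (use that face in auto)
  have 0: "line_integral A w (singular_face 2 0 \<sigma>) = integral {0..1} (form_along A w (\<lambda>u. ?F (1, u)))"
    by (rule *[where T = "\<lambda>u. triangle_point (square_to_triangle (1, u))"])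
      (auto simp: simplical_face_def segment_point_def triangle_point_def square_to_triangle_def fun_eq_iff)
  have 1: "line_integral A w (singular_face 2 1 \<sigma>) = integral {0..1} (form_along A w (\<lambda>s. ?F (s, 1)))"
    by (rule *[where T = "\<lambda>s. triangle_point (square_to_triangle (s, 1))"])
      (auto simp: simplical_face_def segment_point_def triangle_point_def square_to_triangle_def fun_eq_iff)
  have 2: "line_integral A w (singular_face 2 2 \<sigma>) = integral {0..1} (form_along A w (\<lambda>s. ?F (s, 0)))"
    by (rule *[where T = "\<lambda>s. triangle_point (square_to_triangle (s, 0))"])
      (auto simp: simplical_face_def segment_point_def triangle_point_def square_to_triangle_def fun_eq_iff)
  \<comment> \<open>Only a chart around the image of vertex 0 is wanted here, in which the collapsed
    edge is a constant curve.\<close>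
  obtain U \<phi> N g where ch: "(U, \<phi>) \<in> A" and "open N" "(0, 0) \<in> N" "Ck 2 N g" "g ` N \<subseteq> \<phi> ` U"
    "\<forall>y\<in>N \<inter> {0..1} \<times> {0..1}. ?F y \<in> U \<and> g y = \<phi> (?F y)"
    by (rule smooth_squareE[OF smooth_square_simplex[OF \<sigma>], of "(0, 0)"]) auto
  then have origin: "?F (0, 0) \<in> U" by auto
  have "(\<lambda>u. ?F (0, u)) = (\<lambda>_. ?F (0, 0))"
    by (simp add: square_to_triangle_def)
  then have "integral {0..1} (form_along A w (\<lambda>u. ?F (0, u))) = integral {0..1} (form_along A w (\<lambda>_. ?F (0, 0)))"
    by (simp only:)
  also have "\<dots> = integral {0..1::real} (\<lambda>_. 0)"
  proof (rule Henstock_Kurzweil_Integration.integral_cong)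
    fix t :: real assume "t \<in> {0..1}"
    then show "form_along A w (\<lambda>_. ?F (0, 0)) t = 0"
      by (rule form_along_const[OF X w ch origin])
  qed
  finally have "integral {0..1} (form_along A w (\<lambda>u. ?F (0, u))) = 0" by simp
  with stokes_square[OF X w closed smooth_square_simplex[OF \<sigma>]]
  have "integral {0..1} (form_along A w (\<lambda>s. ?F (s, 1))) - integral {0..1} (form_along A w (\<lambda>s. ?F (s, 0))) =
    integral {0..1} (form_along A w (\<lambda>u. ?F (1, u)))"
    by simp
  \<comment> \<open>Faces 0, 1, 2 are the edges s = 1, u = 1, u = 0, so the identity for the square
    reads L 1 - L 2 = L 0.\<close>
  moreover have "(\<Sum>k\<le>2. (-1) ^ k * L k) = L 0 - L 1 + L 2" for L :: "nat \<Rightarrow> real"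
    by (simp add: numeral_2_eq_2)
  ultimately show ?thesis by (simp only: 0 1 2)
qed

end

section \<open>Phases along loops\<close>

text \<open>Linear extension of an arbitrary function \<open>I\<close> on singular simplices. Point
  evaluation with n = 1 gives the vanishing of exact forms on loops, line integrals with n = 2 give
  Stokes' theorem for chains.\<close>

lemma sum_boundary_Continuous:
  fixes M :: "('n::euclidean_space, 'm, 'e::euclidean_space) geometry"
  assumes M: "M = Continuous X A" and c: "c \<in> chains M n" and n: "n > 0"
  shows "(\<Sum>\<tau> | boundary M n c (Singular \<tau>) \<noteq> 0. boundary M n c (Singular \<tau>) * I \<tau>) =
    (\<Sum>\<sigma> | c (Singular \<sigma>) \<noteq> 0. c (Singular \<sigma>) * (\<Sum>k\<le>n. (-1) ^ k * I (singular_face n k \<sigma>)))"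
proof -
  define S where "S = {\<sigma>. c (Singular \<sigma>) \<noteq> 0}"
  have supp: "{\<tau>. c \<tau> \<noteq> 0} = Singular ` S"
    using c by (auto simp: chains_def M S_def)
  have inj: "inj_on Singular S" by (auto intro: inj_onI)
  have "finite {\<tau>. c \<tau> \<noteq> 0}" using c by (simp add: chains_def)
  then have S: "finite S" using finite_imageD[OF _ inj] supp by simp
  \<comment> \<open>All faces that occur in \<open>c\<close>. The support of the boundary may be
    smaller, as faces can cancel; summing over the finite set \<open>T\<close> permits exchanging
    the sums.\<close>
  define T where "T = (\<Union>\<sigma>\<in>S. (\<lambda>k. singular_face n k \<sigma>) ` {..n})"
  have T: "finite T" using S by (simp add: T_def)
  have bd: "boundary M n c (Singular \<tau>) =
      (\<Sum>\<sigma>\<in>S. c (Singular \<sigma>) * (\<Sum>k\<le>n. (-1) ^ k * (if \<tau> = singular_face n k \<sigma> then 1 else 0)))" for \<tau>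
    using n by (simp add: boundary_def supp sum.reindex[OF inj] M)
  have "boundary M n c (Singular \<tau>) = 0" if "\<tau> \<notin> T" for \<tau>
  proof -
    have "(\<Sum>k\<le>n. (-1) ^ k * (if \<tau> = singular_face n k \<sigma> then 1 else 0)) = (0::real)" if "\<sigma> \<in> S" for \<sigma>
      using that \<open>\<tau> \<notin> T\<close> by (intro sum.neutral) (auto simp: T_def)
    then show ?thesis by (simp add: bd)
  qed
  then have "(\<Sum>\<tau> | boundary M n c (Singular \<tau>) \<noteq> 0. boundary M n c (Singular \<tau>) * I \<tau>) =
      (\<Sum>\<tau>\<in>T. boundary M n c (Singular \<tau>) * I \<tau>)"
    by (intro sum.mono_neutral_left T) auto
  also have "\<dots> = (\<Sum>\<sigma>\<in>S. c (Singular \<sigma>) *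
      (\<Sum>k\<le>n. (-1) ^ k * (\<Sum>\<tau>\<in>T. if \<tau> = singular_face n k \<sigma> then I \<tau> else 0)))"
    unfolding bd sum_distrib_right sum_distrib_left
    by (subst sum.swap, intro sum.cong refl, subst sum.swap, intro sum.cong refl) simp
  also have "\<dots> = (\<Sum>\<sigma>\<in>S. c (Singular \<sigma>) * (\<Sum>k\<le>n. (-1) ^ k * I (singular_face n k \<sigma>)))"
  proof (intro sum.cong refl arg_cong[where f = "(*) _"])
    fix \<sigma> k assume "\<sigma> \<in> S" "k \<in> {..n}"
    then have "singular_face n k \<sigma> \<in> T" unfolding T_def by blast
    then show "(\<Sum>\<tau>\<in>T. if \<tau> = singular_face n k \<sigma> then I \<tau> else 0) = I (singular_face n k \<sigma>)"
      by (simp add: sum.delta[OF T])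
  qed
  finally show ?thesis by (simp add: S_def)
qed

lemma singular_in_chain:
  assumes "c \<in> chains (Continuous X A) n" "c (Singular \<sigma>) \<noteq> 0"
  shows "smooth_singular_simplex n X A \<sigma>"
  using assms by (auto simp: chains_def)

lemma pairing_cohomologous_loop:
  fixes M :: "('n::euclidean_space, 'm, 'e::euclidean_space) geometry"
  assumes M: "valid_geometry M" and f: "f \<in> forms M 0"
    and v: "v \<in> forms M 1" and w: "w \<in> forms M 1" and eq: "v = coboundary M 0 f + w"
    and \<gamma>: "\<gamma> \<in> loops M"
  shows "pairing M v \<gamma> = pairing M w \<gamma>"
proof (cases M)
  case (Discrete K ori)
  have bd: "boundary (Discrete K ori :: ('n, 'm, 'e) geometry) (Suc 0) \<gamma> = 0"
    using \<gamma> by (simp add: loops_def Discrete)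
  have z: "(0 :: ('n, 'm) rchain) \<in> chains (Discrete K ori :: ('n, 'm, 'e) geometry) 0"
    by (simp add: chains_def)
  have lin: "\<forall>c \<in> chains (Discrete K ori :: ('n, 'm, 'e) geometry) 0.
      \<forall>c' \<in> chains (Discrete K ori :: ('n, 'm, 'e) geometry) 0. \<forall>a b.
        f (Chain (\<lambda>\<sigma>. a * c \<sigma> + b * c' \<sigma>)) = a * f (Chain c) + b * f (Chain c')"
    using f unfolding Discrete forms.simps mem_Collect_eq by (elim conjE)
  \<comment> \<open>On a loop the exact part takes the value of \<open>f\<close> at the zero chain,
    which linearity with both coefficients 0 forces to vanish.\<close>
  from bspec[OF bspec[OF lin z] z, rule_format, of 0 0]
  have "f (Chain (\<lambda>\<sigma>. 0)) = 0" by simp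
  then have "f (Chain 0) = 0" by (simp add: zero_fun_def)
  then show ?thesis using bd by (simp add: Discrete eq)
next
  case (Continuous X A)
  have X: "smooth_manifold X A" using M Continuous by simp
  have chain: "\<gamma> \<in> chains M 1" and bd: "boundary M 1 \<gamma> = 0"
    using \<gamma> by (auto simp: loops_def)
  let ?I = "\<lambda>\<tau>. eval_at A f (\<tau> (\<lambda>i. if i = 0 then 1 else 0))"
  have "pairing M v \<gamma> = (\<Sum>\<sigma> | \<gamma> (Singular \<sigma>) \<noteq> 0. \<gamma> (Singular \<sigma>) *
      (line_integral A w \<sigma> + (\<Sum>k\<le>1. (-1) ^ k * ?I (singular_face 1 k \<sigma>))))"
    unfolding Continuous pairing.simps
  proof (rule sum.cong[OF refl])
    fix \<sigma> assume "\<sigma> \<in> {\<sigma>. \<gamma> (Singular \<sigma>) \<noteq> 0}"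
    then have "smooth_singular_simplex 1 X A \<sigma>"
      using chain by (auto intro: singular_in_chain simp: Continuous)
    from line_integral_cohomologous[OF X f[unfolded Continuous] v[unfolded Continuous]
        w[unfolded Continuous] eq[unfolded Continuous] this]
    show "\<gamma> (Singular \<sigma>) * line_integral A v \<sigma> = \<gamma> (Singular \<sigma>) *
        (line_integral A w \<sigma> + (\<Sum>k\<le>1. (-1) ^ k * ?I (singular_face 1 k \<sigma>)))"
      by simp
  qed
  also have "\<dots> = pairing M w \<gamma> + (\<Sum>\<sigma> | \<gamma> (Singular \<sigma>) \<noteq> 0. \<gamma> (Singular \<sigma>) *
      (\<Sum>k\<le>1. (-1) ^ k * ?I (singular_face 1 k \<sigma>)))"
    by (simp only: Continuous pairing.simps distrib_left sum.distrib)
  \<comment> \<open>The extra sum is the pairing of \<open>f\<close> with the boundary of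
    \<open>\<gamma>\<close>, a sum over an empty support.\<close>
  also have "\<dots> = pairing M w \<gamma>"
    using sum_boundary_Continuous[OF Continuous chain, of ?I] bd by simp
  finally show ?thesis .
qed

lemma pairing_boundary:
  fixes M :: "('n::euclidean_space, 'm, 'e::euclidean_space) geometry"
  assumes M: "valid_geometry M" and w: "w \<in> forms M 1" and closed: "coboundary M 1 w = 0"
    and c: "c \<in> chains M 2"
  shows "pairing M w (boundary M 2 c) = 0"
proof (cases M)
  case (Discrete K ori)
  \<comment> \<open>The discrete coboundary evaluates \<open>w\<close> on the boundary, so this
    already is the claim.\<close>
  have "coboundary M 1 w (Chain c) = 0" unfolding closed by simp
  then show ?thesis using c by (simp add: Discrete numeral_2_eq_2)
next
  case (Continuous X A)
  have X: "smooth_manifold X A" using M Continuous by simp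
  have "pairing M w (boundary M 2 c) = (\<Sum>\<sigma> | c (Singular \<sigma>) \<noteq> 0. c (Singular \<sigma>) *
      (\<Sum>k\<le>2. (-1) ^ k * line_integral A w (singular_face 2 k \<sigma>)))"
    using sum_boundary_Continuous[OF Continuous c, of "line_integral A w"] by (simp add: Continuous)
  also have "\<dots> = 0"
  proof (rule sum.neutral, rule ballI)
    fix \<sigma> assume "\<sigma> \<in> {\<sigma>. c (Singular \<sigma>) \<noteq> 0}"
    then have "smooth_singular_simplex 2 X A \<sigma>"
      using c by (auto intro: singular_in_chain simp: Continuous)
    from stokes_simplex[OF X w[unfolded Continuous] closed[unfolded Continuous] this]
    show "c (Singular \<sigma>) * (\<Sum>k\<le>2. (-1) ^ k * line_integral A w (singular_face 2 k \<sigma>)) = 0"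
      by simp
  qed
  finally show ?thesis .
qed

text \<open>The same index and the same loop witness both sides.\<close>

lemma contextual_sector_iff_monodromy:
  assumes S: "geometric_encoding I S" and flat: "\<forall>i\<in>I. curvature S i = 0"
  shows "\<not> noncontextual_sector I S \<longleftrightarrow> monodromy_sector I S"
proof -
  have M: "valid_geometry (geom S)" using S by (simp add: geometric_encoding_def)
  have phase: "pairing (geom S) (valuation S i) \<gamma> = pairing (geom S) (connection S i) \<gamma>"
    if "i \<in> I" "\<gamma> \<in> loops (geom S)" for i \<gamma>
    using S that(1)
    by (intro pairing_cohomologous_loop[OF M _ _ _ _ that(2), where f = "potential S i"])
      (auto simp: geometric_encoding_def)
  have "pairing (geom S) (connection S i) \<gamma> = 0"
    if "i \<in> I" "\<gamma> \<in> boundary (geom S) 2 ` chains (geom S) 2" for i \<gamma>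
  proof -
    have "connection S i \<in> forms (geom S) 1" and "coboundary (geom S) 1 (connection S i) = 0"
      using S flat that(1) by (auto simp: geometric_encoding_def curvature_def)
    with that(2) show ?thesis by (auto intro: pairing_boundary[OF M])
  qed
  with phase show ?thesis unfolding noncontextual_sector_def monodromy_sector_def by metis
qed

theorem theorem6:
  fixes p :: "'x::euclidean_space \<Rightarrow> 'y::euclidean_space \<Rightarrow> 'z::euclidean_space \<Rightarrow> real"
    and \<Lambda> :: "'l set"
    and \<E> :: "('x, 'l, 'n1::euclidean_space, 'm1, 'e1::euclidean_space) sector"
    and \<T> :: "('y, 'l \<times> 'l, 'n2::euclidean_space, 'm2, 'e2::euclidean_space) sector"
    and \<P> :: "('z, 'l, 'n3::euclidean_space, 'm3, 'e3::euclidean_space) sector"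
  assumes "ontic_representation p \<Lambda> \<E> \<T> \<P>"
    and "\<forall>l'\<in>\<Lambda>. curvature \<E> l' = 0"
    and "\<forall>l'\<in>\<Lambda>. \<forall>l\<in>\<Lambda>. curvature \<T> (l', l) = 0"
    and "\<forall>l\<in>\<Lambda>. curvature \<P> l = 0"
  shows "contextual \<Lambda> \<E> \<T> \<P> \<longleftrightarrow> exhibits_monodromy \<Lambda> \<E> \<T> \<P>"
proof -
  have enc: "geometric_encoding \<Lambda> \<E>" "geometric_encoding (\<Lambda> \<times> \<Lambda>) \<T>" "geometric_encoding \<Lambda> \<P>"
    using assms(1) by (simp_all add: ontic_representation_def)
  have "\<forall>i\<in>\<Lambda> \<times> \<Lambda>. curvature \<T> i = 0" using assms(3) by blast
  from contextual_sector_iff_monodromy[OF enc(1) assms(2)]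
    contextual_sector_iff_monodromy[OF enc(2) this]
    contextual_sector_iff_monodromy[OF enc(3) assms(4)]
  show ?thesis unfolding contextual_def exhibits_monodromy_def by blast
qed

end
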